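(* Let $f:\mathbb{R}^{m\times n}\to\mathbb{R}$ be continuously differentiable and consider the problem (rank-MOA): minimize $f(X)$ subject to $X\in\mathcal{L}\cap\mathbb{R}(r)$. Let $X\in\mathcal{L}\cap\mathbb{R}(r)$ with $\mathrm{rank}(X)=s$, with a fixed singular value decomposition $X=U\Sigma(X)V^\top$. (i) Suppose that $X$ is a local minimizer of (rank-MOA). If either $s=r$ and Assumption 1 holds at $X$ (the matrices $T^1_X,\dots,T^l_X$ are linearly independent), or $s<r$, Assumption 2 holds at $X$ (the matrices $R^1_X,\dots,R^l_X$ are linearly independent) and $\mathrm{N}^F_{\mathbb{R}_X(r)}(X)\subseteq\mathrm{T}_{\mathcal{L}}(X)$, then there exists $y\in\mathbb{R}^l$ such that, for every $\alpha$ with $0<\alpha<\beta$, where $\beta=\sigma_r(X)/\|\nabla_XL(X,y)\|_2$ if $\nabla_XL(X,y)\ne0$ and $\beta=\infty$ otherwise, $X$ is an $\alpha$-stationary point of (rank-MOA) with multiplier $y$. (ii) Suppose that $f$ is convex and $X$ is an $\alpha$-stationary point of (rank-MOA) for some $\alpha>0$. If $s=r$, then $X$ is a global minimizer of (rank-MOA) restricted on $\mathbb{R}_X(r)$, i.e. $f(X)\le f(Y)$ for all $Y\in\mathcal{L}\cap\mathbb{R}_X(r)$. If $s<r$, then $X$ is a global minimizer of (rank-MOA).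
   Context: Let $m\ge n$ and $1\le r<n$ be integers. $\mathbb{R}^{m\times n}$ carries the inner product $\langle X,Y\rangle=\sum_{ij}X_{ij}Y_{ij}$ and Frobenius norm $\|\cdot\|_F$; $\|\cdot\|_2$ is the spectral norm and $\sigma_r(X)$ the $r$-th largest singular value of $X$. Given $A^1,\dots,A^l\in\mathbb{R}^{m\times n}$ and $b_1,\dots,b_l\in\mathbb{R}$, set $\mathcal{L}=\{X\in\mathbb{R}^{m\times n}:\langle A^i,X\rangle=b_i,\ i=1,\dots,l\}$ and $\mathbb{R}(r)=\{X\in\mathbb{R}^{m\times n}:\mathrm{rank}(X)\le r\}$. Cones. The polar of a cone $\mathcal{K}$ is $\mathcal{K}^\circ=\{Y:\langle Y,X\rangle\le 0\ \forall X\in\mathcal{K}\}$. For a nonempty closed set $\Omega\subseteq\mathbb{R}^{m\times n}$ and $X\in\Omega$, the Bouligand tangent cone $\mathrm{T}^B_\Omega(X)$ is the set of all $\Xi$ for which there are $X^k\in\Omega$ with $X^k\to X$ and $t_k>0$ with $t_k\to0$ such that $t_k^{-1}(X^k-X)\to\Xi$; the Fréchet normal cone is $\mathrm{N}^F_\Omega(X)=[\mathrm{T}^B_\Omega(X)]^\circ$. For the affine set $\mathcal{L}$ one writes $\mathrm{T}_{\mathcal{L}}(X)=\mathrm{T}^B_{\mathcal{L}}(X)$. SVD and the set $\mathbb{R}_X(r)$. For $X\in\mathbb{R}^{m\times n}$ of rank $s$ fix an SVD $X=U\Sigma(X)V^\top$, with $U\in\mathbb{R}^{m\times m}$, $V\in\mathbb{R}^{n\times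 n}$ orthogonal and $\Sigma(X)$ the (rectangular) diagonal $m\times n$ matrix of singular values; $\Gamma\subseteq\{1,\dots,n\}$, $|\Gamma|=s$, is the index set of the nonzero singular values, $\Gamma_m^\perp=\{1,\dots,m\}\setminus\Gamma$, $\Gamma_n^\perp=\{1,\dots,n\}\setminus\Gamma$. For an index set $J$, $U_J$ (resp. $V_J$) is the submatrix of columns of $U$ (resp. $V$) indexed by $J$. Let $\mathcal{J}=\{J\subseteq\{1,\dots,n\}:|J|=r,\ \Gamma\subseteq J\}$, $\mathbb{R}_X(J)=\{U_JAV_J^\top:A\in\mathbb{R}^{r\times r}\}$ for $J\in\mathcal{J}$, and $\mathbb{R}_X(r)=\bigcup_{J\in\mathcal{J}}\mathbb{R}_X(J)\subseteq\mathbb{R}(r)$ (these depend on the chosen $U,V$). For $i=1,\dots,l$ define the block matrices $$T^i_X=\begin{bmatrix}U_\Gamma^\top A^iV_\Gamma & U_\Gamma^\top A^iV_{\Gamma_n^\perp}\\ U_{\Gamma_m^\perp}^\top A^iV_\Gamma & 0\end{bmatrix},\qquad R^i_X=\begin{bmatrix}U_\Gamma^\top A^iV_\Gamma & 0\\ 0&0\end{bmatrix}.$$ Stationarity. The Lagrangian is $L(X,y)=f(X)+\sum_{i=1}^l y_i(\langle A^i,X\rangle-b_i)$, so $\nabla_XL(X,y)=\nabla f(X)+\sum_i y_iA^i$. For $\alpha>0$, a matrix $X\in\mathbb{R}(r)$ is an $\alpha$-stationary point of (rank-MOA) with multiplier $y\in\mathbb{R}^l$ if $\langle A^i,X\rangle=b_i$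 for all $i$ and $X\in\Pi_{\mathbb{R}(r)}(X-\alpha\nabla_XL(X,y))$, where $\Pi_{\mathbb{R}(r)}(Z)=\mathrm{argmin}_{Y\in\mathbb{R}(r)}\|Y-Z\|_F$ (set-valued); it is an $\alpha$-stationary point if this holds for some $y\in\mathbb{R}^l$. *)

theory Defs
  imports "HOL-Analysis.Analysis" "HOL-Library.Multiset"
begin

text \<open>
  An \<open>m \<times> n\<close> matrix is an element of \<^typ>\<open>real^'n^'m\<close>; its library inner product and norm are
  the entrywise inner product and the Frobenius norm. The index types play the roles of
  \<open>{1..m}\<close> and \<open>{1..n}\<close>. Since \<open>n \<le> m\<close>, one has \<open>{1..n} \<subseteq> {1..m}\<close> (a column
  index of \<open>V\<close> is also a column index of \<open>U\<close>); here this inclusion is an injection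
  \<open>\<iota> :: 'n \<Rightarrow> 'm\<close>, passed as a parameter.
\<close>

section \<open>Sets, cones and minimizers\<close>

definition affine_set :: "nat \<Rightarrow> (nat \<Rightarrow> real^'n^'m) \<Rightarrow> (nat \<Rightarrow> real) \<Rightarrow> (real^'n^'m) set" where
  "affine_set l A b = {X. \<forall>i\<in>{1..l}. A i \<bullet> X = b i}"

definition rank_le :: "nat \<Rightarrow> (real^'n^'m) set" where
  "rank_le r = {X. rank X \<le> r}"

definition polar_cone :: "'a::real_inner set \<Rightarrow> 'a set" where
  "polar_cone K = {Y. \<forall>X\<in>K. Y \<bullet> X \<le> 0}"

definition bouligand_tangent :: "'a::real_normed_vector set \<Rightarrow> 'a \<Rightarrow> 'a set" where
  "bouligand_tangent S X =
    {\<Xi>. \<exists>(Z :: nat \<Rightarrow> 'a) (t :: nat \<Rightarrow> real).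
        (\<forall>k. Z k \<in> S) \<and> Z \<longlonglongrightarrow> X \<and> (\<forall>k. 0 < t k) \<and> t \<longlonglongrightarrow> 0 \<and>
        (\<lambda>k. inverse (t k) *\<^sub>R (Z k - X)) \<longlonglongrightarrow> \<Xi>}"

definition frechet_normal :: "'a::real_inner set \<Rightarrow> 'a \<Rightarrow> 'a set" where
  "frechet_normal S X = polar_cone (bouligand_tangent S X)"

definition proj_set :: "'a::real_normed_vector set \<Rightarrow> 'a \<Rightarrow> 'a set" where
  "proj_set S Z = {Y \<in> S. \<forall>W\<in>S. norm (Y - Z) \<le> norm (W - Z)}"

definition local_minimizer :: "('a::metric_space \<Rightarrow> real) \<Rightarrow> 'a set \<Rightarrow> 'a \<Rightarrow> bool" where
  "local_minimizer f S X \<longleftrightarrow>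
    X \<in> S \<and> (\<exists>\<epsilon>>0. \<forall>Y\<in>S. dist Y X < \<epsilon> \<longrightarrow> f X \<le> f Y)"

definition global_minimizer :: "('a \<Rightarrow> real) \<Rightarrow> 'a set \<Rightarrow> 'a \<Rightarrow> bool" where
  "global_minimizer f S X \<longleftrightarrow> X \<in> S \<and> (\<forall>Y\<in>S. f X \<le> f Y)"

section \<open>Singular values and singular value decompositions\<close>

definition spectral_norm :: "real^'n^'m \<Rightarrow> real" where
  "spectral_norm X = onorm (\<lambda>v. X *v v)"

text \<open>
  The singular values of \<open>X\<close> are the nonnegative square roots of the eigenvalues of \<open>X\<^sup>T X\<close>; the
  multiplicity of \<open>t\<close> is the dimension of the eigenspace for \<open>t\<^sup>2\<close>. So the multiset below has
  \<open>n\<close> elements, with zeros included.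
\<close>

definition sv_eigenspace :: "real^'n^'m \<Rightarrow> real \<Rightarrow> (real^'n) set" where
  "sv_eigenspace X t = {v. (transpose X ** X) *v v = t\<^sup>2 *\<^sub>R v}"

definition singular_values :: "real^'n^'m \<Rightarrow> real multiset" where
  "singular_values X =
    (\<Sum>t\<in>{t. 0 \<le> t \<and> sv_eigenspace X t \<noteq> {0}}. replicate_mset (dim (sv_eigenspace X t)) t)"

text \<open>The \<open>k\<close>-th largest singular value, counted with multiplicity, for \<open>1 \<le> k \<le> n\<close>.\<close>

definition singular_value :: "nat \<Rightarrow> real^'n^'m \<Rightarrow> real" where
  "singular_value k X = rev (sorted_list_of_multiset (singular_values X)) ! (k - 1)"

definition rect_diag :: "('n \<Rightarrow> 'm) \<Rightarrow> real^'n \<Rightarrow> real^'n^'m" where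
  "rect_diag \<iota> d = (\<chi> p q. if p = \<iota> q then d $ q else 0)"

text \<open>The diagonal entries need not be listed in decreasing order.\<close>

definition is_svd ::
  "('n \<Rightarrow> 'm) \<Rightarrow> real^'n^'m \<Rightarrow> real^'m^'m \<Rightarrow> real^'n \<Rightarrow> real^'n^'n \<Rightarrow> bool" where
  "is_svd \<iota> X U d V \<longleftrightarrow>
    orthogonal_matrix U \<and> orthogonal_matrix V \<and> (\<forall>q. 0 \<le> d $ q) \<and>
    X = U ** rect_diag \<iota> d ** transpose V"

definition nz_index :: "real^'n \<Rightarrow> 'n set" where
  "nz_index d = {q. d $ q \<noteq> 0}"

text \<open>
  \<open>U\<^sub>J A V\<^sub>J\<^sup>T\<close> entrywise; the rows and columns of the \<open>r \<times> r\<close> matrix \<open>A\<close> are indexed by the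
  \<open>r\<close>-element set \<open>J\<close> itself.
\<close>

definition RXJ :: "('n \<Rightarrow> 'm) \<Rightarrow> real^'m^'m \<Rightarrow> real^'n^'n \<Rightarrow> 'n set \<Rightarrow> (real^'n^'m) set" where
  "RXJ \<iota> U V J =
    {(\<chi> p q. \<Sum>i\<in>J. \<Sum>j\<in>J. U $ p $ \<iota> i * A i j * V $ q $ j) | A :: 'n \<Rightarrow> 'n \<Rightarrow> real. True}"

definition RX ::
  "('n \<Rightarrow> 'm) \<Rightarrow> real^'m^'m \<Rightarrow> real^'n \<Rightarrow> real^'n^'n \<Rightarrow> nat \<Rightarrow> (real^'n^'m) set" where
  "RX \<iota> U d V r = (\<Union>J\<in>{J. card J = r \<and> nz_index d \<subseteq> J}. RXJ \<iota> U V J)"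

section \<open>Constraint qualifications\<close>

text \<open>
  The block matrices are written in the original index order: the \<open>(p, q)\<close> entry of the block
  \<open>U\<^sub>I\<^sup>T A V\<^sub>J\<close> is the \<open>(p, q)\<close> entry of \<open>U\<^sup>T A V\<close> with \<open>p \<in> I\<close>, \<open>q \<in> J\<close>. The displayed form lists
  \<open>\<Gamma>\<close> before its complements, a permutation of rows and columns that does not depend on \<open>A\<close>.
\<close>

definition T_block ::
  "('n \<Rightarrow> 'm) \<Rightarrow> real^'m^'m \<Rightarrow> real^'n \<Rightarrow> real^'n^'n \<Rightarrow> real^'n^'m \<Rightarrow> real^'n^'m" where
  "T_block \<iota> U d V A =
    (\<chi> p q. if p \<in> \<iota> ` nz_index d \<or> q \<in> nz_index d then (transpose U ** A ** V) $ p $ q else 0)"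

definition R_block ::
  "('n \<Rightarrow> 'm) \<Rightarrow> real^'m^'m \<Rightarrow> real^'n \<Rightarrow> real^'n^'n \<Rightarrow> real^'n^'m \<Rightarrow> real^'n^'m" where
  "R_block \<iota> U d V A =
    (\<chi> p q. if p \<in> \<iota> ` nz_index d \<and> q \<in> nz_index d then (transpose U ** A ** V) $ p $ q else 0)"

definition independent_family :: "'i set \<Rightarrow> ('i \<Rightarrow> 'a::real_vector) \<Rightarrow> bool" where
  "independent_family I B \<longleftrightarrow> inj_on B I \<and> independent (B ` I)"

definition assumption1 ::
  "('n \<Rightarrow> 'm) \<Rightarrow> real^'m^'m \<Rightarrow> real^'n \<Rightarrow> real^'n^'n \<Rightarrow> nat \<Rightarrow> (nat \<Rightarrow> real^'n^'m) \<Rightarrow> bool" where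
  "assumption1 \<iota> U d V l A \<longleftrightarrow> independent_family {1..l} (\<lambda>i. T_block \<iota> U d V (A i))"

definition assumption2 ::
  "('n \<Rightarrow> 'm) \<Rightarrow> real^'m^'m \<Rightarrow> real^'n \<Rightarrow> real^'n^'n \<Rightarrow> nat \<Rightarrow> (nat \<Rightarrow> real^'n^'m) \<Rightarrow> bool" where
  "assumption2 \<iota> U d V l A \<longleftrightarrow> independent_family {1..l} (\<lambda>i. R_block \<iota> U d V (A i))"

section \<open>Stationarity\<close>

definition lagrangian ::
  "(real^'n^'m \<Rightarrow> real) \<Rightarrow> nat \<Rightarrow> (nat \<Rightarrow> real^'n^'m) \<Rightarrow> (nat \<Rightarrow> real) \<Rightarrow>
    real^'n^'m \<Rightarrow> (nat \<Rightarrow> real) \<Rightarrow> real" where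
  "lagrangian f l A b X y = f X + (\<Sum>i=1..l. y i * (A i \<bullet> X - b i))"

text \<open>Here \<open>g\<close> is the gradient of \<open>f\<close>.\<close>

definition lagr_grad ::
  "(real^'n^'m \<Rightarrow> real^'n^'m) \<Rightarrow> nat \<Rightarrow> (nat \<Rightarrow> real^'n^'m) \<Rightarrow>
    real^'n^'m \<Rightarrow> (nat \<Rightarrow> real) \<Rightarrow> real^'n^'m" where
  "lagr_grad g l A X y = g X + (\<Sum>i=1..l. y i *\<^sub>R A i)"

lemma gderiv_lagrangian:
  assumes "GDERIV f X :> g X"
  shows "GDERIV (\<lambda>X. lagrangian f l A b X y) X :> lagr_grad g l A X y"
  using assms unfolding gderiv_def lagrangian_def lagr_grad_def
  by (auto intro!: derivative_eq_intros
      simp: inner_add_right inner_sum_right inner_commute)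

definition alpha_stationary_with ::
  "(real^'n^'m \<Rightarrow> real^'n^'m) \<Rightarrow> nat \<Rightarrow> (nat \<Rightarrow> real^'n^'m) \<Rightarrow> (nat \<Rightarrow> real) \<Rightarrow> nat \<Rightarrow>
    real \<Rightarrow> (nat \<Rightarrow> real) \<Rightarrow> real^'n^'m \<Rightarrow> bool" where
  "alpha_stationary_with g l A b r \<alpha> y X \<longleftrightarrow>
    X \<in> rank_le r \<and> (\<forall>i\<in>{1..l}. A i \<bullet> X = b i) \<and>
    X \<in> proj_set (rank_le r) (X - \<alpha> *\<^sub>R lagr_grad g l A X y)"

definition alpha_stationary ::
  "(real^'n^'m \<Rightarrow> real^'n^'m) \<Rightarrow> nat \<Rightarrow> (nat \<Rightarrow> real^'n^'m) \<Rightarrow> (nat \<Rightarrow> real) \<Rightarrow> nat \<Rightarrow>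
    real \<Rightarrow> real^'n^'m \<Rightarrow> bool" where
  "alpha_stationary g l A b r \<alpha> X \<longleftrightarrow> (\<exists>y. alpha_stationary_with g l A b r \<alpha> y X)"

definition step_bound ::
  "(real^'n^'m \<Rightarrow> real^'n^'m) \<Rightarrow> nat \<Rightarrow> (nat \<Rightarrow> real^'n^'m) \<Rightarrow> nat \<Rightarrow>
    real^'n^'m \<Rightarrow> (nat \<Rightarrow> real) \<Rightarrow> ereal" where
  "step_bound g l A r X y =
    (if lagr_grad g l A X y \<noteq> 0
     then ereal (singular_value r X / spectral_norm (lagr_grad g l A X y)) else \<infinity>)"

end

theory Submission
  imports Defs
begin

text \<open>
  Part (i), \<open>s = r\<close>. The map \<open>(E, F) \<mapsto> (I + E) X (I + F)\<close> does not increase the rank and its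
  derivative at the origin is onto the tangent space of the manifold of matrices of rank \<open>r\<close>, so the
  Lagrange multiplier rule for the composed problem, whose constraint qualification is
  Assumption 1, yields \<open>y\<close> such that \<open>G = \<nabla>\<^sub>X L(X, y)\<close> satisfies \<open>G X\<^sup>T = 0\<close> and \<open>X\<^sup>T G = 0\<close>. Then \<open>X\<close>
  is the sum of the \<open>r\<close> dominant singular components of \<open>X - \<alpha> G\<close> as soon as
  \<open>\<alpha> \<parallel>G\<parallel>\<^sub>2 \<le> \<sigma>\<^sub>r(X)\<close>.

  Part (i), \<open>s < r\<close>. Here \<open>\<sigma>\<^sub>r(X) = 0\<close>, so an admissible \<open>\<alpha>\<close> exists only if the gradient of the
  Lagrangian vanishes, and then \<open>X\<close> is its own projection; every \<open>y\<close> is a witness.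

  Part (ii). Stationarity makes \<open>G\<close> orthogonal to every direction along which a whole line through
  \<open>X\<close> stays in \<open>\<real>(r)\<close>. For \<open>s < r\<close> these include all matrix units, so \<open>G = 0\<close>; for \<open>s = r\<close> the
  set \<open>\<real>\<^sub>X(r)\<close> is a linear space of such directions. Convexity of \<open>f\<close> concludes.
\<close>

section \<open>Lagrange multipliers\<close>

text \<open>Collect the \<open>k b\<close> into one map \<open>\<Psi>\<close>, with the
  \<open>b\<close> as basis vectors of the target. Its derivative at \<open>x\<close> is invertible
  because the gradients form a basis, so the image of a ball around \<open>x\<close> contains a
  neighbourhood of 0, and a small positive multiple of any prescribed vector of increments is
  attained.\<close>

lemma open_mapping_gradient_basis:
  fixes k :: "'a::euclidean_space \<Rightarrow> 'a \<Rightarrow> real"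
  assumes B: "independent B" "span B = UNIV"
    and cont: "\<And>b. b \<in> B \<Longrightarrow> continuous_on UNIV (k b)"
    and deriv: "\<And>b. b \<in> B \<Longrightarrow> GDERIV (k b) x :> b"
    and "0 < \<epsilon>"
  obtains \<delta> z where "0 < \<delta>" "dist z x < \<epsilon>" "\<And>b. b \<in> B \<Longrightarrow> k b z = k b x + \<delta> * c b"
proof -
  have fin: "finite B"
    using B(1) by (rule independent_imp_finite)
  define \<Psi> where "\<Psi> z = (\<Sum>b\<in>B. (k b z - k b x) *\<^sub>R b)" for z
  define D where "D h = (\<Sum>b\<in>B. (h \<bullet> b) *\<^sub>R b)" for h :: 'a
  have lin: "linear D"
    unfolding D_def
    by (intro linearI) (simp_all add: inner_add_left scaleR_add_left sum.distrib scaleR_sum_right)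
  have "h = 0" if "D h = 0" for h
  proof -
    \<comment> \<open>Pairing \<open>D h\<close> with \<open>h\<close> gives a sum of squares, so
      \<open>D h = 0\<close> makes \<open>h\<close> orthogonal to \<open>B\<close>, hence to its
      span, which contains \<open>h\<close> itself.\<close>
    have "(\<Sum>b\<in>B. (h \<bullet> b)\<^sup>2) = h \<bullet> D h"
      unfolding D_def by (simp add: inner_sum_right power2_eq_square)
    then have "\<forall>b\<in>B. h \<bullet> b = 0"
      using that fin by (simp add: sum_nonneg_eq_0_iff)
    then have "h \<bullet> h = 0"
      using B(2) by (metis UNIV_I orthogonal_def orthogonal_to_span)
    then show ?thesis by simp
  qed
  then have "inj D"
    using lin by (simp add: linear_injective_0)
  then obtain D' where D': "linear D'" "\<And>h. D (D' h) = h"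
    using linear_injective_isomorphism[OF lin] by auto
  have "(\<Psi> has_derivative D) (at x)"
    unfolding \<Psi>_def D_def using deriv unfolding gderiv_def
    by (auto intro!: derivative_eq_intros)
  moreover have "continuous_on UNIV \<Psi>"
    unfolding \<Psi>_def using cont by (auto intro!: continuous_intros)
  ultimately have "\<Psi> x \<in> interior (\<Psi> ` ball x \<epsilon>)"
    using D' \<open>0 < \<epsilon>\<close>
    by (intro sussmann_open_mapping[where S = UNIV and f' = D and g' = D'])
      (auto simp: linear_linear o_def fun_eq_iff)
  then obtain e where e: "0 < e" "ball 0 e \<subseteq> \<Psi> ` ball x \<epsilon>"
    unfolding mem_interior by (auto simp: \<Psi>_def)
  define w where "w = (\<Sum>b\<in>B. c b *\<^sub>R b)"
  \<comment> \<open>The summand 1 keeps the denominator positive when \<open>w = 0\<close> and makes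
    the norm of \<open>\<delta> *\<^sub>R w\<close> strictly smaller than \<open>e\<close>.\<close>
  define \<delta> where "\<delta> = e / (1 + norm w)"
  have "0 < \<delta>"
    unfolding \<delta>_def using e(1) by (simp add: add_pos_nonneg)
  have "e * norm w < e * (1 + norm w)"
    using e(1) by simp
  then have "norm (\<delta> *\<^sub>R w) < e"
    using e(1) unfolding \<delta>_def by (simp add: divide_less_eq add_pos_nonneg)
  then have "\<delta> *\<^sub>R w \<in> \<Psi> ` ball x \<epsilon>"
    using e(2) by auto
  then obtain z where z: "dist z x < \<epsilon>" "\<Psi> z = \<delta> *\<^sub>R w"
    by (metis dist_commute imageE mem_ball)
  have "(\<Sum>b\<in>B. (k b z - k b x - \<delta> * c b) *\<^sub>R b) = 0"
    using z(2) unfolding \<Psi>_def w_def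
    by (simp add: scaleR_diff_left sum_subtractf scaleR_sum_right)
  then have "\<forall>b\<in>B. k b z - k b x - \<delta> * c b = 0"
    using independentD[OF B(1) fin subset_refl, where u = "\<lambda>b. k b z - k b x - \<delta> * c b"]
    by simp
  then show ?thesis
    using that[OF \<open>0 < \<delta>\<close> z(1)] by (simp add: algebra_simps)
qed

text \<open>Were \<open>g\<close> outside the span, \<open>g\<close> and the \<open>a i\<close>
  would extend to a basis, and the open mapping argument would give a point within
  \<open>\<epsilon>\<close> of \<open>x\<close> at which every \<open>h i\<close> is unchanged and
  \<open>h0\<close> is strictly lower.\<close>

lemma lagrange_multiplier:
  fixes x :: "'a::euclidean_space"
  assumes indep: "inj_on a I" "independent (a ` I)"
    and g: "GDERIV h0 x :> g" "continuous_on UNIV h0"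
    and a: "\<And>i. i \<in> I \<Longrightarrow> GDERIV (h i) x :> a i" "\<And>i. i \<in> I \<Longrightarrow> continuous_on UNIV (h i)"
    and "0 < \<epsilon>"
    and min: "\<And>z. dist z x < \<epsilon> \<Longrightarrow> (\<And>i. i \<in> I \<Longrightarrow> h i z = h i x) \<Longrightarrow> h0 x \<le> h0 z"
  shows "g \<in> span (a ` I)"
proof (rule ccontr)
  assume g_notin: "g \<notin> span (a ` I)"
  then have "independent (insert g (a ` I))"
    using indep(2) by (simp add: independent_insertI)
  then obtain B where B: "insert g (a ` I) \<subseteq> B" "independent B" "UNIV \<subseteq> span B"
    using maximal_independent_subset_extend[of "insert g (a ` I)" UNIV] by auto
  from B(3) have spanB: "span B = UNIV" by auto
  \<comment> \<open>Each vector is assigned a function having it as gradient at \<open>x\<close>: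
    the objective for \<open>g\<close>, a constraint for \<open>a i\<close>, and a linear functional
    for the vectors that complete the basis.\<close>
  define k where "k b = (if b = g then h0 else if b \<in> a ` I then h (inv_into I a b) else (\<lambda>z. z \<bullet> b))" for b
  have g': "g \<notin> a ` I"
    using g_notin by (metis span_base)
  have ka: "k (a i) = h i" if "i \<in> I" for i
    using that g' indep(1) by (auto simp: k_def)
  have cont: "continuous_on UNIV (k b)" for b
    using g a by (auto simp: k_def inv_into_into intro!: continuous_intros)
  have der: "GDERIV (k b) x :> b" for b
  proof -
    consider "b = g" | i where "i \<in> I" "b = a i" | "b \<noteq> g" "b \<notin> a ` I" by blast
    then show ?thesis
    proof cases
      case 1
      then show ?thesis using g by (simp add: k_def)
    next
      case 2
      then show ?thesis using a ka by simp
    next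
      case 3
      then show ?thesis unfolding gderiv_def k_def by (auto intro!: derivative_eq_intros)
    qed
  qed
  obtain \<delta> z where z: "0 < \<delta>" "dist z x < \<epsilon>"
    "\<And>b. b \<in> B \<Longrightarrow> k b z = k b x + \<delta> * (if b = g then -1 else 0)"
    using open_mapping_gradient_basis[OF B(2) spanB cont der \<open>0 < \<epsilon>\<close>, of "\<lambda>b. if b = g then -1 else 0"]
    by blast
  have "h i z = h i x" if "i \<in> I" for i
  proof -
    have "a i \<in> B" "a i \<noteq> g"
      using that B(1) g' by auto
    then show ?thesis
      using z(3)[of "a i"] ka[OF that] by simp
  qed
  then have "h0 x \<le> h0 z"
    using min z(2) by blast
  moreover have "h0 z = h0 x - \<delta>"
    using z(3)[of g] B(1) by (simp add: k_def)
  ultimately show False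
    using z(1) by simp
qed

section \<open>Linear relations in indexed families\<close>

lemma independent_family_iff:
  assumes "finite I"
  shows "independent_family I B \<longleftrightarrow> (\<forall>c. (\<Sum>i\<in>I. c i *\<^sub>R B i) = 0 \<longrightarrow> (\<forall>i\<in>I. c i = 0))"
    (is "_ \<longleftrightarrow> ?R")
proof
  assume L: "independent_family I B"
  show ?R
  proof (intro allI impI)
    fix c assume "(\<Sum>i\<in>I. c i *\<^sub>R B i) = 0"
    then have "(\<Sum>v\<in>B ` I. c (inv_into I B v) *\<^sub>R v) = 0"
      using L by (simp add: independent_family_def sum.reindex)
    then have "\<forall>v\<in>B ` I. c (inv_into I B v) = 0"
      using L assms independentD[of "B ` I" "B ` I" "\<lambda>v. c (inv_into I B v)"]
      unfolding independent_family_def by blast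
    then show "\<forall>i\<in>I. c i = 0"
      using L by (simp add: independent_family_def)
  qed
next
  assume R: ?R
  have inj: "inj_on B I"
  proof (rule inj_onI, rule ccontr)
    fix i j assume ij: "i \<in> I" "j \<in> I" "B i = B j" "i \<noteq> j"
    \<comment> \<open>A repeated vector gives the relation \<open>B i - B j = 0\<close>, whose
      coefficients do not all vanish.\<close>
    define c where "c k = (if k = i then 1 else 0) - (if k = j then 1 else (0::real))" for k
    have "(\<Sum>k\<in>I. c k *\<^sub>R B k) = (\<Sum>k\<in>I. (if k = i then B k else 0) - (if k = j then B k else 0))"
      by (rule sum.cong) (auto simp: c_def)
    also have "\<dots> = 0"
      using ij assms by (simp add: sum_subtractf)
    finally have "c i = 0"
      using R ij by blast
    then show False using ij by (simp add: c_def)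
  qed
  moreover have "independent (B ` I)"
  proof (rule independent_if_scalars_zero)
    fix c v assume "(\<Sum>v\<in>B ` I. c v *\<^sub>R v) = 0" "v \<in> B ` I"
    then show "c v = 0"
      using R inj by (auto simp: sum.reindex)
  qed (use assms in auto)
  ultimately show "independent_family I B"
    by (simp add: independent_family_def)
qed

lemma span_family:
  assumes "finite I" "g \<in> span (a ` I)"
  shows "\<exists>y. g = (\<Sum>i\<in>I. y i *\<^sub>R a i)"
  using assms
proof (induction I arbitrary: g rule: finite_induct)
  case (insert j I)
  from insert.prems obtain k where "g - k *\<^sub>R a j \<in> span (a ` I)"
    by (auto simp: span_breakdown_eq)
  then obtain y where y: "g - k *\<^sub>R a j = (\<Sum>i\<in>I. y i *\<^sub>R a i)"
    using insert.IH by blast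
  have "(\<Sum>i\<in>insert j I. (y(j := k)) i *\<^sub>R a i) = k *\<^sub>R a j + (\<Sum>i\<in>I. (y(j := k)) i *\<^sub>R a i)"
    using insert by simp
  also have "(\<Sum>i\<in>I. (y(j := k)) i *\<^sub>R a i) = (\<Sum>i\<in>I. y i *\<^sub>R a i)"
    using insert by (intro sum.cong) auto
  finally have "g = (\<Sum>i\<in>insert j I. (y(j := k)) i *\<^sub>R a i)"
    using y by (simp add: algebra_simps)
  then show ?case by blast
qed simp

section \<open>Singular value decompositions and low-rank approximation\<close>

lemma norm_sq_matrix_columns:
  fixes M :: "real^'n^'m"
  shows "(norm M)\<^sup>2 = (\<Sum>j\<in>UNIV. (norm (column j M))\<^sup>2)"
  unfolding power2_norm_eq_inner inner_vec_def column_def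
  by (subst sum.swap) simp

lemma inner_matrix_columns:
  fixes M N :: "real^'n^'m"
  shows "M \<bullet> N = (\<Sum>j\<in>UNIV. column j M \<bullet> column j N)"
  unfolding inner_vec_def column_def by (subst sum.swap) simp

lemma transpose_mult_nth:
  fixes M :: "real^'n^'m"
  shows "(transpose M *v b) $ j = column j M \<bullet> b"
  by (simp add: matrix_vector_mult_def transpose_def column_def inner_vec_def)

lemma inner_transpose_mult:
  fixes M :: "real^'n^'m"
  shows "(transpose M *v x) \<bullet> y = x \<bullet> (M *v y)"
  by (metis adjoint_matrix adjoint_works matrix_vector_mul_linear transpose_transpose inner_commute)

lemma norm_orthogonal_matrix_mult:
  fixes Q :: "real^'n^'n"
  assumes "orthogonal_matrix Q"
  shows "norm (Q *v x) = norm x"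
  using assms orthogonal_transformation_matrix[of "(*v) Q"]
  by (simp add: orthogonal_transformation_norm)

lemma parseval:
  fixes B :: "'a::euclidean_space set"
  assumes "finite B" "pairwise orthogonal B" "\<And>b. b \<in> B \<Longrightarrow> norm b = 1"
  shows "(\<Sum>b\<in>B. (x \<bullet> b) *\<^sub>R b) \<bullet> (\<Sum>b\<in>B. (y \<bullet> b) *\<^sub>R b) = (\<Sum>b\<in>B. (x \<bullet> b) * (y \<bullet> b))"
proof -
  have o: "(\<Sum>b\<in>B. (x \<bullet> b) *\<^sub>R b) \<bullet> c = x \<bullet> c" if "c \<in> B" for c
  proof -
    have "(\<Sum>b\<in>B. (x \<bullet> b) *\<^sub>R b) \<bullet> c = (\<Sum>b\<in>B. if b = c then x \<bullet> c else 0)"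
      unfolding inner_sum_left
      using that assms by (intro sum.cong) (auto simp: pairwise_def orthogonal_def norm_eq_1)
    then show ?thesis using that assms by simp
  qed
  show ?thesis
    by (subst inner_sum_right, rule sum.cong) (simp_all add: o)
qed

lemma bessel:
  fixes B :: "'a::euclidean_space set"
  assumes "finite B" "pairwise orthogonal B" "\<And>b. b \<in> B \<Longrightarrow> norm b = 1"
  shows "(\<Sum>b\<in>B. (x \<bullet> b)\<^sup>2) \<le> (norm x)\<^sup>2"
proof -
  define p where "p = (\<Sum>b\<in>B. (x \<bullet> b) *\<^sub>R b)"
  have "p \<bullet> p = (\<Sum>b\<in>B. (x \<bullet> b)\<^sup>2)"
    using parseval[OF assms, of x x] by (simp add: p_def power2_eq_square)
  moreover have "x \<bullet> p = (\<Sum>b\<in>B. (x \<bullet> b)\<^sup>2)"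
    by (simp add: p_def inner_sum_right power2_eq_square)
  moreover have "0 \<le> (x - p) \<bullet> (x - p)" by simp
  ultimately show ?thesis
    by (simp add: inner_diff_left inner_diff_right inner_commute power2_norm_eq_inner)
qed

text \<open>The projection \<open>p\<close> of \<open>m\<close> onto the span is its closest point
  there: since \<open>w \<bullet> p = m \<bullet> w\<close>, expanding
  \<open>0 \<le> (w - p) \<bullet> (w - p)\<close> is all that is required.\<close>

lemma dist_span_orthonormal:
  fixes B :: "'a::euclidean_space set"
  assumes B: "finite B" "pairwise orthogonal B" "\<And>b. b \<in> B \<Longrightarrow> norm b = 1"
    and w: "w \<in> span B"
  shows "(norm m)\<^sup>2 - (\<Sum>b\<in>B. (m \<bullet> b)\<^sup>2) \<le> (norm (w - m))\<^sup>2"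
proof -
  define p where "p = (\<Sum>b\<in>B. (m \<bullet> b) *\<^sub>R b)"
  have wexp: "(\<Sum>b\<in>B. (w \<bullet> b) *\<^sub>R b) = w"
    using orthonormal_basis_expand B w by blast
  have "p \<bullet> p = (\<Sum>b\<in>B. (m \<bullet> b)\<^sup>2)"
    using parseval[OF B, of m m] by (simp add: p_def power2_eq_square)
  moreover have "w \<bullet> p = (\<Sum>b\<in>B. (w \<bullet> b) * (m \<bullet> b))"
    using parseval[OF B, of w m] by (simp add: p_def wexp)
  moreover have "m \<bullet> w = (\<Sum>b\<in>B. (w \<bullet> b) * (m \<bullet> b))"
    by (subst wexp[symmetric]) (simp add: inner_sum_right)
  moreover have "0 \<le> (w - p) \<bullet> (w - p)" by simp
  ultimately show ?thesis
    by (simp add: inner_diff_left inner_diff_right inner_commute power2_norm_eq_inner)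
qed

section \<open>Matrix identities in the bases of a singular value decomposition\<close>

lemma rect_diag_transpose_mult:
  "(transpose (rect_diag \<iota> d) *v c) $ q = d $ q * c $ \<iota> q"
  by (simp add: transpose_mult_nth rect_diag_def column_def inner_vec_def
      if_distrib[of "\<lambda>t. t * _"] del: transpose_matrix_vector cong: if_cong)

lemma svd_transpose_mult:
  assumes "is_svd \<iota> X U d V"
  shows "(norm (transpose X *v b))\<^sup>2 = (\<Sum>q\<in>UNIV. (d $ q)\<^sup>2 * (column (\<iota> q) U \<bullet> b)\<^sup>2)"
proof -
  have "transpose X *v b = V *v (transpose (rect_diag \<iota> d) *v (transpose U *v b))"
    using assms
    by (simp add: is_svd_def matrix_transpose_mul matrix_vector_mul_assoc matrix_mul_assoc
        del: transpose_matrix_vector)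
  then have "norm (transpose X *v b) = norm (transpose (rect_diag \<iota> d) *v (transpose U *v b))"
    using assms by (simp add: is_svd_def norm_orthogonal_matrix_mult)
  moreover have "(norm (transpose (rect_diag \<iota> d) *v c))\<^sup>2 = (\<Sum>q\<in>UNIV. (d $ q)\<^sup>2 * (c $ \<iota> q)\<^sup>2)" for c
    unfolding power2_norm_eq_inner inner_vec_def rect_diag_transpose_mult
    by (simp add: power2_eq_square mult_ac)
  ultimately show ?thesis
    by (simp only: transpose_mult_nth)
qed

text \<open>The rows of \<open>X\<close> are the vectors \<open>transpose X *v axis p 1\<close>.
  Summing the preceding identity over \<open>p\<close> leaves the squared norms of columns of
  \<open>U\<close>, which are 1.\<close>

lemma svd_norm:
  fixes X :: "real^'n^'m"
  assumes svd: "is_svd \<iota> X U d V"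
  shows "(norm X)\<^sup>2 = (\<Sum>q\<in>UNIV. (d $ q)\<^sup>2)"
proof -
  have "(transpose X *v axis p 1) $ q = X $ p $ q" for p q
    by (simp only: transpose_mult_nth inner_axis) (simp add: column_def)
  then have "(norm X)\<^sup>2 = (\<Sum>p\<in>UNIV. (norm (transpose X *v axis p 1))\<^sup>2)"
    unfolding power2_norm_eq_inner inner_vec_def by simp
  also have "\<dots> = (\<Sum>q\<in>UNIV. (d $ q)\<^sup>2 * (\<Sum>p\<in>UNIV. (column (\<iota> q) U \<bullet> axis p 1)\<^sup>2))"
    unfolding svd_transpose_mult[OF svd] sum_distrib_left by (rule sum.swap)
  also have "\<dots> = (\<Sum>q\<in>UNIV. (d $ q)\<^sup>2 * (norm (column (\<iota> q) U))\<^sup>2)"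
    unfolding power2_norm_eq_inner inner_vec_def[of "column _ U" "column _ U"]
    by (simp add: inner_axis power2_eq_square)
  finally show ?thesis
    using svd by (simp add: is_svd_def orthogonal_matrix_orthonormal_columns)
qed


lemma svd_column_orthonormal:
  assumes "is_svd \<iota> X U d V" "inj \<iota>"
  shows "column (\<iota> p) U \<bullet> column (\<iota> q) U = (if p = q then 1 else 0)"
  using assms
  by (auto simp: is_svd_def orthogonal_matrix_orthonormal_columns orthogonal_def inj_eq
      norm_eq_1 dest: injD)

lemma orthogonal_matrix_mult_cancel:
  fixes Q :: "real^'n^'n"
  assumes "orthogonal_matrix Q"
  shows "Q ** M = Q ** N \<longleftrightarrow> M = N" "M' ** Q = N' ** Q \<longleftrightarrow> M' = N'"
proof -
  have "M = transpose Q ** (Q ** M)" for M :: "real^'k^'n"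
    using assms by (simp add: matrix_mul_assoc orthogonal_matrix_def)
  then show "Q ** M = Q ** N \<longleftrightarrow> M = N" by metis
  have "M' = (M' ** Q) ** transpose Q" for M' :: "real^'n^'j"
    using assms by (simp add: matrix_mul_assoc[symmetric] orthogonal_matrix_def)
  then show "M' ** Q = N' ** Q \<longleftrightarrow> M' = N'" by metis
qed

text \<open>Multiplication by orthogonal matrices on both sides turns the two products into
  \<open>B\<close> times the transposed diagonal matrix, from the right and from the left. The
  diagonal scales the columns, respectively the rows, of \<open>B\<close> by the entries of
  \<open>d\<close>, so only those in \<open>nz_index d\<close> are forced to vanish.\<close>

lemma svd_mult_transpose_zero_iff:
  fixes G :: "real^'n^'m"
  assumes svd: "is_svd \<iota> X U d V" and "inj \<iota>"
  shows "G ** transpose X = 0 \<longleftrightarrow> (\<forall>p. \<forall>q\<in>nz_index d. (transpose U ** G ** V) $ p $ q = 0)"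
    and "transpose X ** G = 0 \<longleftrightarrow> (\<forall>p\<in>\<iota> ` nz_index d. \<forall>q. (transpose U ** G ** V) $ p $ q = 0)"
proof -
  have U: "orthogonal_matrix U" "orthogonal_matrix (transpose U)"
    and V: "orthogonal_matrix V" "orthogonal_matrix (transpose V)"
    and X: "X = U ** rect_diag \<iota> d ** transpose V"
    using svd by (auto simp: is_svd_def)
  have inv: "transpose U ** U = mat 1" "transpose V ** V = mat 1"
    using U V by (simp_all add: orthogonal_matrix_def)
  define B where "B = transpose U ** G ** V"
  let ?D = "transpose (rect_diag \<iota> d)"
  have "G ** transpose X = 0 \<longleftrightarrow> transpose U ** (G ** transpose X) ** U = transpose U ** 0 ** U"
    by (simp only: orthogonal_matrix_mult_cancel U)
  also have "transpose U ** (G ** transpose X) ** U = B ** ?D ** (transpose U ** U)"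
    by (simp only: X B_def matrix_transpose_mul transpose_transpose matrix_mul_assoc)
  also have "\<dots> = B ** ?D"
    by (simp add: inv)
  also have "B ** ?D = transpose U ** 0 ** U \<longleftrightarrow> (\<forall>p. \<forall>q\<in>nz_index d. B $ p $ q = 0)"
  proof -
    have "(B ** ?D) $ p $ p' = (\<Sum>q\<in>UNIV. if p' = \<iota> q then B $ p $ q * d $ q else 0)" for p p'
      unfolding matrix_matrix_mult_def[of _ ?D]
      by (simp add: transpose_def rect_diag_def if_distrib[of "\<lambda>t. _ * t"] cong: if_cong)
    moreover from this have "(B ** ?D) $ p $ \<iota> q = B $ p $ q * d $ q" for p q
      using \<open>inj \<iota>\<close> by (simp add: inj_eq)
    ultimately have "B ** ?D = 0 \<longleftrightarrow> (\<forall>p q. B $ p $ q * d $ q = 0)"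
      by (fastforce simp: vec_eq_iff intro!: sum.neutral)
    then show ?thesis by (auto simp: nz_index_def)
  qed
  finally show "G ** transpose X = 0 \<longleftrightarrow> (\<forall>p. \<forall>q\<in>nz_index d. (transpose U ** G ** V) $ p $ q = 0)"
    by (simp only: B_def)
  have "transpose X ** G = 0 \<longleftrightarrow> transpose V ** (transpose X ** G) ** V = transpose V ** 0 ** V"
    by (simp only: orthogonal_matrix_mult_cancel V)
  also have "transpose V ** (transpose X ** G) ** V = (transpose V ** V) ** (?D ** B)"
    by (simp only: X B_def matrix_transpose_mul transpose_transpose matrix_mul_assoc)
  also have "\<dots> = ?D ** B"
    by (simp add: inv)
  also have "?D ** B = transpose V ** 0 ** V \<longleftrightarrow> (\<forall>p\<in>\<iota> ` nz_index d. \<forall>q. B $ p $ q = 0)"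
  proof -
    have "(?D ** B) $ q $ q' = d $ q * B $ \<iota> q $ q'" for q q'
      unfolding matrix_matrix_mult_def[of ?D]
      by (simp add: transpose_def rect_diag_def if_distrib[of "\<lambda>t. t * _"] cong: if_cong)
    then show ?thesis
      by (auto simp: vec_eq_iff nz_index_def)
  qed
  finally show "transpose X ** G = 0 \<longleftrightarrow> (\<forall>p\<in>\<iota> ` nz_index d. \<forall>q. (transpose U ** G ** V) $ p $ q = 0)"
    by (simp only: B_def)
qed

text \<open>The entries kept by \<open>T_block\<close> are exactly those in a row or column that one
  of the two products forces to vanish. This connects Assumption 1 with the derivative of the
  two-sided perturbation of \<open>X\<close>.\<close>

lemma T_block_zero_iff:
  assumes "is_svd \<iota> X U d V" "inj \<iota>"
  shows "T_block \<iota> U d V G = 0 \<longleftrightarrow> G ** transpose X = 0 \<and> transpose X ** G = 0"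
  unfolding svd_mult_transpose_zero_iff[OF assms] by (auto simp: T_block_def vec_eq_iff)

lemma T_block_sum:
  "T_block \<iota> U d V (\<Sum>i\<in>I. c i *\<^sub>R A i) = (\<Sum>i\<in>I. c i *\<^sub>R T_block \<iota> U d V (A i))"
proof -
  have "linear (T_block \<iota> U d V)"
    by (rule linearI)
      (auto simp: T_block_def vec_eq_iff matrix_matrix_mult_def algebra_simps sum.distrib
        sum_distrib_left)
  then show ?thesis
    by (simp add: linear_sum linear_scale)
qed

text \<open>
  An Eckart--Young type inequality; its proof bounds the trace of \<open>(X - H) (X - H)\<^sup>T\<close> on the
  range of \<open>W\<close> as in Ky Fan's maximum principle.
\<close>

lemma best_approximation_orthogonal_perturbation:
  fixes X H W :: "real^'n^'m"
  assumes svd: "is_svd \<iota> X U d V" "inj \<iota>"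
    and HX: "H ** transpose X = 0" "transpose X ** H = 0"
    and \<sigma>: "\<And>w. norm (transpose H *v w) \<le> \<sigma> * norm w" "0 \<le> \<sigma>" "\<And>q. q \<in> nz_index d \<Longrightarrow> \<sigma> \<le> d $ q"
    and W: "rank W \<le> card (nz_index d)"
  shows "norm (X - (X - H)) \<le> norm (W - (X - H))"
proof -
  define M where "M = X - H"
  define u where "u q = column (\<iota> q) U" for q
  let ?\<Gamma> = "nz_index d"
  have u: "u p \<bullet> u q = (if p = q then 1 else 0)" for p q
    using svd_column_orthonormal[OF svd] by (simp add: u_def)
  obtain B where B: "pairwise orthogonal B" "\<And>b. b \<in> B \<Longrightarrow> norm b = 1" "independent B"
    "card B = dim (range ((*v) W))" "span B = range ((*v) W)"
    using orthonormal_basis_subspace[OF linear_subspace_image[OF matrix_vector_mul_linear[of W] subspace_UNIV]]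
    by metis
  have fin: "finite B" using B(3) by (rule independent_imp_finite)
  have cardB: "card B \<le> card ?\<Gamma>" using B(4) W by (simp add: rank_dim_range)
  have XH0: "X ** transpose H = 0"
  proof -
    have "X ** transpose H = transpose (H ** transpose X)"
      by (simp add: matrix_transpose_mul)
    then show ?thesis by (simp only: HX) (simp add: transpose_def vec_eq_iff)
  qed
  have inner0: "X \<bullet> H = 0"
  proof -
    have "column j X \<bullet> column j H = (transpose X ** H) $ j $ j" for j
      by (simp add: column_def inner_vec_def matrix_matrix_mult_def transpose_def)
    then show ?thesis by (simp add: inner_matrix_columns HX)
  qed
  have normM: "(norm M)\<^sup>2 = (norm X)\<^sup>2 + (norm H)\<^sup>2"
    using inner0 by (simp add: M_def power2_norm_eq_inner inner_diff_left inner_diff_right inner_commute)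
  \<comment> \<open>Every column of \<open>W\<close> lies in the span of \<open>B\<close>, so its
    distance to the matching column of \<open>M\<close> is at least that of the projection; these
    bounds are added over the columns.\<close>
  have tail: "(norm M)\<^sup>2 - (\<Sum>b\<in>B. (norm (transpose M *v b))\<^sup>2) \<le> (norm (W - M))\<^sup>2"
  proof -
    have "(norm (column j M))\<^sup>2 - (\<Sum>b\<in>B. (column j M \<bullet> b)\<^sup>2) \<le> (norm (column j W - column j M))\<^sup>2" for j
    proof (rule dist_span_orthonormal[OF fin B(1,2)])
      show "column j W \<in> span B"
        unfolding B(5) by (metis matrix_vector_mult_basis rangeI)
    qed
    then have "(\<Sum>j\<in>UNIV. (norm (column j M))\<^sup>2 - (\<Sum>b\<in>B. (column j M \<bullet> b)\<^sup>2))
        \<le> (\<Sum>j\<in>UNIV. (norm (column j W - column j M))\<^sup>2)"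
      by (rule sum_mono)
    moreover have "column j W - column j M = column j (W - M)" for j
      by (simp add: column_def vec_eq_iff)
    moreover have "(\<Sum>j\<in>UNIV. \<Sum>b\<in>B. (column j M \<bullet> b)\<^sup>2) = (\<Sum>b\<in>B. (norm (transpose M *v b))\<^sup>2)"
      unfolding power2_norm_eq_inner inner_vec_def[of "transpose M *v _"] transpose_mult_nth
      by (subst sum.swap) (simp add: power2_eq_square)
    ultimately show ?thesis
      by (simp add: norm_sq_matrix_columns sum_subtractf)
  qed
  \<comment> \<open>The condition \<open>transpose X ** H = 0\<close> says that the rows of
    \<open>transpose U ** H ** V\<close> belonging to nonzero singular values vanish, so
    \<open>transpose H\<close> annihilates the corresponding left singular vectors.\<close>
  have Hu: "transpose H *v u q = 0" if "q \<in> ?\<Gamma>" for q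
  proof -
    have "(transpose (H ** V) *v u q) $ j = (transpose U ** H ** V) $ \<iota> q $ j" for j
      unfolding matrix_mul_assoc[symmetric] transpose_mult_nth u_def
      unfolding matrix_matrix_mult_def[of "transpose U"]
      by (simp add: transpose_def column_def inner_vec_def mult.commute)
    moreover have "(transpose U ** H ** V) $ \<iota> q $ j = 0" for j
      using svd_mult_transpose_zero_iff(2)[OF svd, of H] HX(2) that by blast
    ultimately have "transpose (H ** V) *v u q = 0"
      by (simp add: vec_eq_iff del: transpose_matrix_vector)
    then have "transpose V *v (transpose H *v u q) = 0"
      by (simp only: matrix_transpose_mul matrix_vector_mul_assoc)
    then have "norm (transpose H *v u q) = 0"
      using norm_orthogonal_matrix_mult[of "transpose V" "transpose H *v u q"] svd(1)
      by (simp add: is_svd_def del: transpose_matrix_vector)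
    then show ?thesis by simp
  qed
  define c where "c q b = (u q \<bullet> b)\<^sup>2" for q b
  \<comment> \<open>The images of \<open>b\<close> under the transposes of \<open>X\<close> and
    \<open>H\<close> are orthogonal since \<open>X ** transpose H = 0\<close>. The first is computed
    from the decomposition; the second depends only on the part \<open>v\<close> of \<open>b\<close>
    orthogonal to the \<open>u q\<close> with \<open>q \<in> nz_index d\<close>.\<close>
  have head: "(norm (transpose M *v b))\<^sup>2 \<le> (\<Sum>q\<in>?\<Gamma>. ((d $ q)\<^sup>2 - \<sigma>\<^sup>2) * c q b) + \<sigma>\<^sup>2"
    if "b \<in> B" for b
  proof -
    define v where "v = b - (\<Sum>q\<in>?\<Gamma>. (u q \<bullet> b) *\<^sub>R u q)"
    have "(norm v)\<^sup>2 = 1 - (\<Sum>q\<in>?\<Gamma>. c q b)"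
    proof -
      have "(\<Sum>q\<in>?\<Gamma>. (u q \<bullet> b) *\<^sub>R u q) \<bullet> u p = u p \<bullet> b" if "p \<in> ?\<Gamma>" for p
        using that by (simp add: inner_sum_left u if_distrib[of "\<lambda>t. _ * t"] cong: if_cong)
      then have "(\<Sum>q\<in>?\<Gamma>. (u q \<bullet> b) *\<^sub>R u q) \<bullet> (\<Sum>q\<in>?\<Gamma>. (u q \<bullet> b) *\<^sub>R u q) = (\<Sum>q\<in>?\<Gamma>. c q b)"
        by (simp add: inner_sum_right[of _ "\<lambda>q. (u q \<bullet> b) *\<^sub>R u q"] c_def power2_eq_square)
      moreover have "b \<bullet> (\<Sum>q\<in>?\<Gamma>. (u q \<bullet> b) *\<^sub>R u q) = (\<Sum>q\<in>?\<Gamma>. c q b)"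
        by (simp add: inner_sum_right c_def power2_eq_square inner_commute)
      moreover have "b \<bullet> b = 1"
        using B(2)[OF \<open>b \<in> B\<close>] by (simp add: norm_eq_1)
      ultimately show ?thesis
        unfolding v_def power2_norm_eq_inner
        by (simp add: inner_diff_left inner_diff_right inner_commute)
    qed
    moreover have "transpose H *v b = transpose H *v v"
      by (simp add: v_def matrix_vector_mult_diff_distrib linear_sum[OF matrix_vector_mul_linear]
        matrix_vector_mult_scaleR Hu del: transpose_matrix_vector)
    ultimately have Hb: "(norm (transpose H *v b))\<^sup>2 \<le> \<sigma>\<^sup>2 * (1 - (\<Sum>q\<in>?\<Gamma>. c q b))"
      using power_mono[OF \<sigma>(1)[of v] norm_ge_zero, of 2] by (simp add: power_mult_distrib)
    have "(transpose X *v b) \<bullet> (transpose H *v b) = b \<bullet> ((X ** transpose H) *v b)"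
      by (simp only: inner_transpose_mult matrix_vector_mul_assoc)
    then have "(transpose X *v b) \<bullet> (transpose H *v b) = 0"
      by (simp add: XH0)
    moreover have "transpose M *v b = transpose X *v b - transpose H *v b"
      by (simp add: M_def transpose_def matrix_vector_mult_def vec_eq_iff sum_subtractf left_diff_distrib
        del: transpose_matrix_vector)
    ultimately have "(norm (transpose M *v b))\<^sup>2 = (norm (transpose X *v b))\<^sup>2 + (norm (transpose H *v b))\<^sup>2"
      by (simp add: power2_norm_eq_inner inner_diff_left inner_diff_right inner_commute
        del: transpose_matrix_vector)
    moreover have "(norm (transpose X *v b))\<^sup>2 = (\<Sum>q\<in>?\<Gamma>. (d $ q)\<^sup>2 * c q b)"
      unfolding svd_transpose_mult[OF svd(1)] c_def u_def
      by (rule sum.mono_neutral_right) (auto simp: nz_index_def)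
    ultimately show ?thesis
      using Hb by (simp add: left_diff_distrib sum_subtractf sum_distrib_left algebra_simps)
  qed
  have "(\<Sum>b\<in>B. (norm (transpose M *v b))\<^sup>2)
      \<le> (\<Sum>b\<in>B. (\<Sum>q\<in>?\<Gamma>. ((d $ q)\<^sup>2 - \<sigma>\<^sup>2) * c q b) + \<sigma>\<^sup>2)"
    by (rule sum_mono) (rule head)
  also have "\<dots> = (\<Sum>q\<in>?\<Gamma>. ((d $ q)\<^sup>2 - \<sigma>\<^sup>2) * (\<Sum>b\<in>B. c q b)) + of_nat (card B) * \<sigma>\<^sup>2"
    by (simp add: sum.distrib sum_distrib_left sum.swap[of _ B])
  \<comment> \<open>The weights are nonnegative, Bessel's inequality bounds each inner sum by 1, and
    the size of \<open>B\<close> is the rank of \<open>W\<close>. The terms with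
    \<open>\<sigma>\<close> then cancel.\<close>
  also have "\<dots> \<le> (\<Sum>q\<in>?\<Gamma>. ((d $ q)\<^sup>2 - \<sigma>\<^sup>2) * 1) + of_nat (card ?\<Gamma>) * \<sigma>\<^sup>2"
  proof (intro add_mono sum_mono mult_left_mono mult_right_mono)
    fix q assume "q \<in> ?\<Gamma>"
    then show "0 \<le> (d $ q)\<^sup>2 - \<sigma>\<^sup>2"
      using \<sigma> by (simp add: power_mono)
    have "norm (u q) = 1" using u[of q q] by (simp add: norm_eq_1)
    then show "(\<Sum>b\<in>B. c q b) \<le> 1"
      using bessel[OF fin B(1,2), of "u q"] by (simp add: c_def)
  qed (use cardB in auto)
  also have "\<dots> = (\<Sum>q\<in>?\<Gamma>. (d $ q)\<^sup>2)"
    by (simp add: sum_subtractf)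
  also have "\<dots> = (norm X)\<^sup>2"
    unfolding svd_norm[OF svd(1)] by (rule sum.mono_neutral_left) (auto simp: nz_index_def)
  \<comment> \<open>Subtracting this bound from the squared norm of \<open>M\<close>, which splits
    into those of \<open>X\<close> and \<open>H\<close>, leaves \<open>H\<close>, the distance from
    \<open>X\<close> to \<open>M\<close>.\<close>
  finally have "(norm H)\<^sup>2 \<le> (norm (W - M))\<^sup>2"
    using tail normM by linarith
  then have "norm H \<le> norm (W - M)"
    by (rule power2_le_imp_le) simp
  then show ?thesis by (simp add: M_def)
qed

section \<open>Rank and singular values read off the diagonal\<close>

lemma dim_orthogonal_image:
  fixes Q :: "real^'n^'n"
  assumes "orthogonal_matrix Q"
  shows "dim ((*v) Q ` {x. \<forall>i. i \<notin> K \<longrightarrow> x $ i = 0}) = card K"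
proof -
  have "inj ((*v) Q)"
    using norm_orthogonal_matrix_mult[OF assms]
    by (intro linear_injective_0[THEN iffD2]) (auto, metis norm_eq_zero)
  then have "dim ((*v) Q ` {x. \<forall>i. i \<notin> K \<longrightarrow> x $ i = 0}) = dim {x :: real^'n. \<forall>i. i \<notin> K \<longrightarrow> x $ i = 0}"
    by (intro dim_image_eq[OF matrix_vector_mul_linear]) (rule inj_on_subset, auto)
  also have "\<dots> = card K"
    using dim_substandard_cart[of K, where 'a = real] by (simp add: dim_vec_eq)
  finally show ?thesis .
qed

lemma rect_diag_mult:
  assumes "inj \<iota>"
  shows "(rect_diag \<iota> d *v x) $ \<iota> q = d $ q * x $ q"
    and "p \<notin> \<iota> ` nz_index d \<Longrightarrow> (rect_diag \<iota> d *v x) $ p = 0"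
proof -
  have e: "(rect_diag \<iota> d *v x) $ p = (\<Sum>q\<in>UNIV. if p = \<iota> q then d $ q * x $ q else 0)" for p
    by (simp add: rect_diag_def matrix_vector_mult_def if_distrib[of "\<lambda>t. t * _"] cong: if_cong)
  show "(rect_diag \<iota> d *v x) $ \<iota> q = d $ q * x $ q"
    unfolding e using assms by (simp add: inj_eq)
  show "(rect_diag \<iota> d *v x) $ p = 0" if "p \<notin> \<iota> ` nz_index d"
    unfolding e using that by (intro sum.neutral) (auto simp: nz_index_def)
qed

lemma svd_rank:
  fixes X :: "real^'n^'m"
  assumes svd: "is_svd \<iota> X U d V" and "inj \<iota>"
  shows "rank X = card (nz_index d)"
proof -
  have U: "orthogonal_matrix U" and V: "V ** transpose V = mat 1" "transpose V ** V = mat 1"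
    and X: "X = U ** rect_diag \<iota> d ** transpose V"
    using svd by (auto simp: is_svd_def orthogonal_matrix_def)
  have "range ((*v) X) = (*v) U ` {x. \<forall>i. i \<notin> \<iota> ` nz_index d \<longrightarrow> x $ i = 0}" (is "?L = ?R")
  proof
    show "?L \<subseteq> ?R"
      using rect_diag_mult(2)[OF \<open>inj \<iota>\<close>, of _ d]
      by (auto simp: X matrix_vector_mul_assoc[symmetric] simp del: transpose_matrix_vector
          intro!: imageI)
    show "?R \<subseteq> ?L"
    proof safe
      fix c :: "real^'m" assume c: "\<forall>i. i \<notin> \<iota> ` nz_index d \<longrightarrow> c $ i = 0"
      \<comment> \<open>This undoes the scaling by \<open>d\<close>. Where \<open>d $ q = 0\<close>
        the quotient is 0 by convention, and \<open>c\<close> vanishes at \<open>\<iota> q\<close>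
        as well because \<open>\<iota>\<close> is injective.\<close>
      define x where "x = (\<chi> q. c $ \<iota> q / d $ q)"
      have "rect_diag \<iota> d *v x = c"
        unfolding vec_eq_iff
      proof
        fix p
        show "(rect_diag \<iota> d *v x) $ p = c $ p"
          using c rect_diag_mult(1)[OF \<open>inj \<iota>\<close>, of d x] rect_diag_mult(2)[OF \<open>inj \<iota>\<close>, of p d x]
          by (cases "p \<in> \<iota> ` nz_index d") (auto simp: x_def nz_index_def)
      qed
      moreover have "X *v (V *v x) = U *v (rect_diag \<iota> d *v ((transpose V ** V) *v x))"
        by (simp only: X matrix_vector_mul_assoc[symmetric])
      ultimately have "U *v c = X *v (V *v x)"
        by (simp add: V)
      then show "U *v c \<in> range ((*v) X)" by simp
    qed
  qed
  then show ?thesis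
    using \<open>inj \<iota>\<close> U by (simp add: rank_dim_range dim_orthogonal_image card_image inj_on_subset)
qed

text \<open>In the coordinates given by \<open>V\<close> the eigenvalue equation reads
  \<open>(d $ q)\<^sup>2 * x $ q = t\<^sup>2 * x $ q\<close>. As \<open>d $ q\<close> and
  \<open>t\<close> are nonnegative, \<open>x\<close> is free exactly at the indices with
  \<open>d $ q = t\<close>.\<close>

lemma dim_sv_eigenspace:
  assumes svd: "is_svd \<iota> X U d V" and "inj \<iota>" "0 \<le> t"
  shows "dim (sv_eigenspace X t) = card {q. d $ q = t}"
proof -
  have U: "transpose U ** U = mat 1" and V: "orthogonal_matrix V" "V ** transpose V = mat 1" "transpose V ** V = mat 1"
    and d: "\<And>q. 0 \<le> d $ q" and X: "X = U ** rect_diag \<iota> d ** transpose V"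
    using svd by (auto simp: is_svd_def orthogonal_matrix_def)
  have iff: "V *v x \<in> sv_eigenspace X t \<longleftrightarrow> (\<forall>q. q \<notin> {q. d $ q = t} \<longrightarrow> x $ q = 0)" for x
  proof -
    let ?y = "transpose (rect_diag \<iota> d) *v (rect_diag \<iota> d *v x)"
    have "(transpose X ** X) *v (V *v x) = V *v (transpose (rect_diag \<iota> d) *v ((transpose U ** U) *v (rect_diag \<iota> d *v ((transpose V ** V) *v x))))"
      by (simp only: X matrix_transpose_mul transpose_transpose matrix_vector_mul_assoc[symmetric])
    then have XX: "(transpose X ** X) *v (V *v x) = V *v ?y"
      by (simp only: U V matrix_vector_mul_lid)
    have "V *v x \<in> sv_eigenspace X t \<longleftrightarrow> V *v ?y = V *v (t\<^sup>2 *\<^sub>R x)"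
      unfolding sv_eigenspace_def mem_Collect_eq XX matrix_vector_mult_scaleR ..
    also have "\<dots> \<longleftrightarrow> ?y = t\<^sup>2 *\<^sub>R x"
      using V(3) by (metis matrix_vector_mul_assoc matrix_vector_mul_lid)
    also have "\<dots> \<longleftrightarrow> (\<forall>q. (d $ q)\<^sup>2 * x $ q = t\<^sup>2 * x $ q)"
      unfolding vec_eq_iff rect_diag_transpose_mult rect_diag_mult(1)[OF \<open>inj \<iota>\<close>]
      by (simp add: power2_eq_square mult.assoc)
    also have "\<dots> \<longleftrightarrow> (\<forall>q. q \<notin> {q. d $ q = t} \<longrightarrow> x $ q = 0)"
      using d \<open>0 \<le> t\<close> by (auto simp: power2_eq_iff_nonneg)
    finally show ?thesis .
  qed
  have "sv_eigenspace X t = (*v) V ` {x. \<forall>q. q \<notin> {q. d $ q = t} \<longrightarrow> x $ q = 0}"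
  proof (intro equalityI subsetI)
    fix v assume v: "v \<in> sv_eigenspace X t"
    have "v = V *v (transpose V *v v)"
      by (simp only: matrix_vector_mul_assoc V matrix_vector_mul_lid)
    then show "v \<in> (*v) V ` {x. \<forall>q. q \<notin> {q. d $ q = t} \<longrightarrow> x $ q = 0}"
      using v iff[of "transpose V *v v"] by (simp del: transpose_matrix_vector)
  qed (use iff in blast)
  then show ?thesis
    by (simp only: dim_orthogonal_image[OF V(1)])
qed

text \<open>Multiplicities agree by the eigenspace dimensions. Thus the singular values, defined
  without \<open>U\<close> and \<open>V\<close>, can be read off the unordered diagonal of any
  decomposition.\<close>

lemma svd_singular_values:
  assumes svd: "is_svd \<iota> X U d V" and "inj \<iota>"
  shows "singular_values X = image_mset (($) d) (mset_set UNIV)"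
proof (rule multiset_eqI)
  fix a
  have d: "0 \<le> d $ q" for q
    using svd by (simp add: is_svd_def)
  have dims: "dim (sv_eigenspace X t) = card {q. d $ q = t}" if "0 \<le> t" for t
    using dim_sv_eigenspace[OF assms that] .
  have T: "{t. 0 \<le> t \<and> sv_eigenspace X t \<noteq> {0}} = range (($) d)"
  proof -
    have "sv_eigenspace X t \<noteq> {0} \<longleftrightarrow> t \<in> range (($) d)" if "0 \<le> t" for t
    proof -
      have "0 \<in> sv_eigenspace X t" by (simp add: sv_eigenspace_def)
      then have "sv_eigenspace X t \<noteq> {0} \<longleftrightarrow> dim (sv_eigenspace X t) \<noteq> 0"
        by (auto simp: dim_eq_0)
      then show ?thesis
        unfolding dims[OF that] by auto
    qed
    then show ?thesis using d by auto
  qed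
  have "count (singular_values X) a = (\<Sum>t\<in>range (($) d). if t = a then card {q. d $ q = t} else 0)"
    unfolding singular_values_def T count_sum
    by (intro sum.cong) (auto simp: dims d)
  also have "\<dots> = card {q. d $ q = a}"
    by (auto simp: card_eq_0_iff)
  also have "\<dots> = count (image_mset (($) d) (mset_set UNIV)) a"
    by (simp add: count_image_mset' eq_commute)
  finally show "count (singular_values X) a = count (image_mset (($) d) (mset_set UNIV)) a" .
qed

text \<open>In the ascending list the value stands at position \<open>CARD('n) - k\<close>, so it
  and the entries after it are \<open>k\<close> entries that reach it.\<close>

lemma svd_singular_value:
  fixes X :: "real^'n^'m"
  assumes svd: "is_svd \<iota> X U d V" and "inj \<iota>" and k: "1 \<le> k" "k \<le> CARD('n)"
  shows "singular_value k X \<in> range (($) d)" and "k \<le> card {q. singular_value k X \<le> d $ q}"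
proof -
  define xs where "xs = sorted_list_of_multiset (singular_values X)"
  have ms: "mset xs = image_mset (($) d) (mset_set UNIV)"
    by (simp add: xs_def svd_singular_values[OF assms(1,2)])
  have len: "length xs = CARD('n)"
    using arg_cong[OF ms, of size] by simp
  have sorted: "sorted xs" by (simp add: xs_def)
  define \<sigma> where "\<sigma> = singular_value k X"
  have \<sigma>: "\<sigma> = xs ! (CARD('n) - k)"
    using k by (simp add: \<sigma>_def singular_value_def xs_def[symmetric] rev_nth len)
  have "set xs = range (($) d)"
    using arg_cong[OF ms, of set_mset] by simp
  moreover have "\<sigma> \<in> set xs"
    using k by (simp add: \<sigma> len)
  ultimately show "singular_value k X \<in> range (($) d)"
    by (simp add: \<sigma>_def)
  have "filter (\<lambda>t. \<sigma> \<le> t) (drop (CARD('n) - k) xs) = drop (CARD('n) - k) xs"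
    using sorted k by (auto simp: filter_id_conv in_set_conv_nth \<sigma> len intro!: sorted_nth_mono)
  then have "k = length (filter (\<lambda>t. \<sigma> \<le> t) (drop (CARD('n) - k) xs))"
    using k by (simp add: len)
  also have "\<dots> \<le> length (filter (\<lambda>t. \<sigma> \<le> t) (take (CARD('n) - k) xs @ drop (CARD('n) - k) xs))"
    unfolding filter_append by simp
  also have "\<dots> = size (filter_mset (\<lambda>t. \<sigma> \<le> t) (mset xs))"
    by (simp flip: mset_filter)
  also have "\<dots> = card {q. \<sigma> \<le> d $ q}"
    unfolding ms by (simp add: filter_mset_image_mset)
  finally show "k \<le> card {q. singular_value k X \<le> d $ q}"
    by (simp add: \<sigma>_def)
qed

text \<open>A positive value would give at least \<open>k\<close> nonzero diagonal entries, more
  than the rank.\<close>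

lemma svd_singular_value_zero:
  fixes X :: "real^'n^'m"
  assumes svd: "is_svd \<iota> X U d V" and "inj \<iota>" and k: "rank X < k" "k \<le> CARD('n)"
  shows "singular_value k X = 0"
proof (rule ccontr)
  assume "singular_value k X \<noteq> 0"
  moreover have "0 \<le> singular_value k X"
  proof -
    have "singular_value k X \<in> range (($) d)"
      using svd_singular_value(1)[OF assms(1,2)] k by simp
    then show ?thesis using svd by (auto simp: is_svd_def)
  qed
  ultimately have "{q. singular_value k X \<le> d $ q} \<subseteq> nz_index d"
    by (auto simp: nz_index_def)
  then have "card {q. singular_value k X \<le> d $ q} \<le> card (nz_index d)"
    by (intro card_mono) auto
  then show False
    using svd_singular_value(2)[OF assms(1,2), of k] k svd_rank[OF assms(1,2)] by simp
qed

text \<open>If the value is positive, at least \<open>rank X\<close> diagonal entries reach it, and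
  all of these are nonzero. There are only \<open>rank X\<close> nonzero entries, so each of them
  reaches it.\<close>

lemma svd_singular_value_rank_le:
  fixes X :: "real^'n^'m"
  assumes svd: "is_svd \<iota> X U d V" and "inj \<iota>" and r: "1 \<le> rank X" and q: "q \<in> nz_index d"
  shows "singular_value (rank X) X \<le> d $ q"
proof (cases "singular_value (rank X) X \<le> 0")
  case True
  then show ?thesis using svd by (auto simp: is_svd_def intro: order_trans)
next
  case False
  have "rank X \<le> CARD('n)"
    using rank_bound[of X] by simp
  then have "card (nz_index d) \<le> card {q. singular_value (rank X) X \<le> d $ q}"
    using svd_singular_value(2)[OF assms(1,2) r] by (simp add: svd_rank[OF assms(1,2)])
  moreover have "{q. singular_value (rank X) X \<le> d $ q} \<subseteq> nz_index d"
    using False by (auto simp: nz_index_def)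
  ultimately have "{q. singular_value (rank X) X \<le> d $ q} = nz_index d"
    by (simp add: card_seteq)
  then show ?thesis using q by auto
qed

section \<open>Stationarity\<close>

lemma bounded_bilinear_matrix_mult:
  "bounded_bilinear ((**) :: real^'n^'m \<Rightarrow> real^'k^'n \<Rightarrow> real^'k^'m)"
  unfolding bilinear_conv_bounded_bilinear[symmetric] bilinear_def
  by (auto intro!: linearI simp: matrix_matrix_mult_def vec_eq_iff algebra_simps sum.distrib
      sum_distrib_left)

lemma inner_matrix_mult_left:
  fixes E :: "real^'k^'m" and X :: "real^'n^'k" and G :: "real^'n^'m"
  shows "(E ** X) \<bullet> G = E \<bullet> (G ** transpose X)"
proof -
  have "(\<Sum>j\<in>UNIV. (\<Sum>k\<in>UNIV. E $ i $ k * X $ k $ j) * G $ i $ j)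
      = (\<Sum>k\<in>UNIV. E $ i $ k * (\<Sum>j\<in>UNIV. G $ i $ j * X $ k $ j))" for i
    unfolding sum_distrib_left sum_distrib_right
    by (subst sum.swap) (simp add: mult_ac)
  then show ?thesis
    by (simp add: inner_vec_def matrix_matrix_mult_def transpose_def)
qed

lemma inner_transpose_matrix:
  fixes G :: "real^'n^'m"
  shows "transpose F \<bullet> transpose G = F \<bullet> G"
  unfolding inner_vec_def transpose_def by (subst sum.swap) simp

lemma inner_matrix_mult_right:
  fixes X :: "real^'k^'m" and F :: "real^'n^'k" and G :: "real^'n^'m"
  shows "(X ** F) \<bullet> G = F \<bullet> (transpose X ** G)"
proof -
  have "(X ** F) \<bullet> G = (transpose F ** transpose X) \<bullet> transpose G"
    by (metis inner_transpose_matrix matrix_transpose_mul)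
  also have "\<dots> = transpose F \<bullet> transpose (transpose X ** G)"
    by (simp add: inner_matrix_mult_left matrix_transpose_mul)
  finally show ?thesis
    by (simp add: inner_transpose_matrix)
qed

text \<open>A substitute for a chart of the fixed-rank manifold. The domain is a whole vector space,
  so the composed problem keeps only the linear equality constraints on the matrix.\<close>

definition two_sided_perturbation :: "real^'n^'m \<Rightarrow> (real^'m^'m) \<times> (real^'n^'n) \<Rightarrow> real^'n^'m" where
  "two_sided_perturbation X z = (mat 1 + fst z) ** X ** (mat 1 + snd z)"

lemma two_sided_perturbation_0 [simp]: "two_sided_perturbation X 0 = X"
  by (simp add: two_sided_perturbation_def)

lemma rank_two_sided_perturbation: "rank (two_sided_perturbation X z) \<le> rank X"
  unfolding two_sided_perturbation_def by (meson order_trans rank_mul_le_left rank_mul_le_right)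

lemma continuous_on_two_sided_perturbation: "continuous_on S (two_sided_perturbation X)"
  unfolding two_sided_perturbation_def
  by (intro bounded_bilinear.continuous_on[OF bounded_bilinear_matrix_mult] continuous_intros)

text \<open>The derivative at 0 in direction \<open>(E, F)\<close> is
  \<open>E ** X + X ** F\<close>; moving \<open>X\<close> to the other side of the inner product
  gives the two components of the gradient.\<close>

lemma GDERIV_two_sided_perturbation:
  assumes "GDERIV f X :> g"
  shows "GDERIV (\<lambda>z. f (two_sided_perturbation X z)) 0 :> (g ** transpose X, transpose X ** g)"
proof -
  note D = bounded_bilinear.FDERIV[OF bounded_bilinear_matrix_mult]
  note bounded_bilinear.zero_left[OF bounded_bilinear_matrix_mult, simp]
    bounded_bilinear.zero_right[OF bounded_bilinear_matrix_mult, simp]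
  have E: "((\<lambda>z. mat 1 + fst z) has_derivative fst) (at (0 :: (real^'b^'b) \<times> (real^'a^'a)))"
    and F: "((\<lambda>z. mat 1 + snd z) has_derivative snd) (at (0 :: (real^'b^'b) \<times> (real^'a^'a)))"
    by (auto intro!: derivative_eq_intros)
  have "((\<lambda>z. (mat 1 + fst z) ** X) has_derivative (\<lambda>h. fst h ** X)) (at (0 :: (real^'b^'b) \<times> (real^'a^'a)))"
    using D[OF E has_derivative_const[of X]] by simp
  from D[OF this F]
  have "(two_sided_perturbation X has_derivative (\<lambda>h. X ** snd h + fst h ** X)) (at 0)"
    by (simp add: two_sided_perturbation_def[abs_def])
  moreover have "(f has_derivative (\<lambda>h. h \<bullet> g)) (at (two_sided_perturbation X 0))"
    using assms by (simp add: gderiv_def)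
  ultimately have "((\<lambda>z. f (two_sided_perturbation X z)) has_derivative (\<lambda>h. (X ** snd h + fst h ** X) \<bullet> g)) (at 0)"
    by (rule has_derivative_compose)
  then show ?thesis
    unfolding gderiv_def
    by (simp add: inner_add_left inner_matrix_mult_left[where X = X]
        inner_matrix_mult_right[where X = X] inner_prod_def add.commute)
qed

text \<open>Since \<open>\<phi>\<close> is continuous and never raises the rank, local minimality of
  \<open>X\<close> passes to 0 in the composed problem. There \<open>N\<close> turns gradients with
  respect to the matrix into gradients with respect to the perturbation, and the two equations say
  that \<open>N\<close> annihilates the gradient of the Lagrangian.\<close>

lemma KKT_full_rank:
  fixes f :: "real^'n^'m \<Rightarrow> real"
  assumes f: "\<And>Z. GDERIV f Z :> grad Z"
    and svd: "is_svd \<iota> X U d V" "inj \<iota>"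
    and min: "local_minimizer f (affine_set l A b \<inter> rank_le (rank X)) X"
    and A1: "assumption1 \<iota> U d V l A"
  obtains y where "lagr_grad grad l A X y ** transpose X = 0" "transpose X ** lagr_grad grad l A X y = 0"
proof -
  define N where "N G = (G ** transpose X, transpose X ** G)" for G
  define \<phi> where "\<phi> = two_sided_perturbation X"
  note \<phi> = rank_two_sided_perturbation[of X, folded \<phi>_def]
    continuous_on_two_sided_perturbation[of UNIV X, folded \<phi>_def]
    GDERIV_two_sided_perturbation[of _ X, folded \<phi>_def]
  have \<phi>0: "\<phi> 0 = X" by (simp add: \<phi>_def)
  have linN: "linear N"
    unfolding N_def
    by (intro linearI) (auto simp: matrix_matrix_mult_def vec_eq_iff algebra_simps sum.distrib
        sum_distrib_left)
  have N0: "N G = 0 \<longleftrightarrow> T_block \<iota> U d V G = 0" for G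
    by (simp add: T_block_zero_iff[OF svd] N_def zero_prod_def)
  \<comment> \<open>The linear maps \<open>N\<close> and \<open>T_block\<close> have the same
    kernel, so the same linear combinations of the \<open>A i\<close> are sent to 0 by both.\<close>
  have "independent_family {1..l} (\<lambda>i. N (A i))"
    using A1 unfolding assumption1_def
    by (simp add: independent_family_iff N0 flip: T_block_sum linear_sum[OF linN] linear_scale[OF linN])
  then have indep: "inj_on (\<lambda>i. N (A i)) {1..l}" "independent ((\<lambda>i. N (A i)) ` {1..l})"
    by (simp_all add: independent_family_def)
  have contf: "continuous_on UNIV f"
    using f unfolding gderiv_def
    by (meson continuous_at_imp_continuous_on has_derivative_continuous)
  have XL: "X \<in> affine_set l A b"
    using min by (simp add: local_minimizer_def)
  obtain e where e: "0 < e" "\<And>Y. Y \<in> affine_set l A b \<Longrightarrow> rank Y \<le> rank X \<Longrightarrow> dist Y X < e \<Longrightarrow> f X \<le> f Y"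
    using min by (auto simp: local_minimizer_def rank_le_def)
  obtain \<epsilon> where \<epsilon>: "0 < \<epsilon>" "\<And>z. dist z 0 < \<epsilon> \<Longrightarrow> dist (\<phi> z) X < e"
    using \<phi>(2) e(1) \<phi>0 unfolding continuous_on_iff by (metis UNIV_I)
  have "N (grad X) \<in> span ((\<lambda>i. N (A i)) ` {1..l})"
  proof (rule lagrange_multiplier[where ?h0.0 = "\<lambda>z. f (\<phi> z)" and h = "\<lambda>i z. A i \<bullet> \<phi> z" and x = 0])
    show "GDERIV (\<lambda>z. f (\<phi> z)) 0 :> N (grad X)"
      unfolding N_def using f by (rule \<phi>(3))
    show "continuous_on UNIV (\<lambda>z. f (\<phi> z))"
      using contf \<phi>(2) by (rule continuous_on_compose2) auto
    show "GDERIV (\<lambda>z. A i \<bullet> \<phi> z) 0 :> N (A i)" for i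
      unfolding N_def
      by (rule \<phi>(3)) (auto simp: gderiv_def inner_commute intro!: derivative_eq_intros)
    show "continuous_on UNIV (\<lambda>z. A i \<bullet> \<phi> z)" for i
      using \<phi>(2) by (intro continuous_intros)
    show "f (\<phi> 0) \<le> f (\<phi> z)" if "dist z 0 < \<epsilon>" "\<And>i. i \<in> {1..l} \<Longrightarrow> A i \<bullet> \<phi> z = A i \<bullet> \<phi> 0" for z
      unfolding \<phi>0
    proof (rule e(2))
      show "\<phi> z \<in> affine_set l A b"
        using that(2) XL by (simp add: affine_set_def \<phi>0)
    qed (use \<epsilon> \<phi>(1) that in auto)
  qed (use indep \<epsilon>(1) in auto)
  then obtain y where "N (grad X) = (\<Sum>i=1..l. y i *\<^sub>R N (A i))"
    using span_family[of "{1..l}"] by blast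
  \<comment> \<open>The sign changes because the multiplier rule writes the gradient as a
    combination of constraint gradients, whereas the Lagrangian adds them to it.\<close>
  then have "N (lagr_grad grad l A X (\<lambda>i. - y i)) = 0"
    by (simp add: lagr_grad_def linear_diff[OF linN] linear_sum[OF linN]
        linear_scale[OF linN] sum_negf)
  then show ?thesis
    using that[of "\<lambda>i. - y i"] by (simp add: N_def zero_prod_def)
qed

section \<open>Spectral norm, projections and convexity\<close>

lemma spectral_norm_nonneg: "0 \<le> spectral_norm G"
  unfolding spectral_norm_def by (intro onorm_pos_le) (auto simp: linear_linear)

text \<open>The squared left side is the inner product of \<open>w\<close> with
  \<open>G *v (transpose G *v w)\<close>; Cauchy-Schwarz and the norm bound for \<open>G\<close>
  leave one factor to cancel.\<close>

lemma norm_transpose_mult_le: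
  "norm (transpose G *v w) \<le> spectral_norm G * norm w"
proof -
  let ?v = "transpose G *v w"
  have "(norm ?v)\<^sup>2 = w \<bullet> (G *v ?v)"
    unfolding power2_norm_eq_inner by (rule inner_transpose_mult)
  also have "\<dots> \<le> norm w * norm (G *v ?v)"
    by (rule norm_cauchy_schwarz)
  also have "\<dots> \<le> norm w * (spectral_norm G * norm ?v)"
    unfolding spectral_norm_def
    by (intro mult_left_mono onorm) (auto simp: linear_linear)
  finally have "norm ?v * norm ?v \<le> (spectral_norm G * norm w) * norm ?v"
    by (simp add: power2_eq_square mult_ac del: transpose_matrix_vector)
  with spectral_norm_nonneg[of G] show ?thesis
    by (metis mult_nonneg_nonneg mult_right_le_imp_le norm_ge_zero order_le_less)
qed

lemma proj_set_orthogonal: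
  fixes X :: "'a::real_inner"
  assumes proj: "X \<in> proj_set S (X - \<alpha> *\<^sub>R G)" and "0 < \<alpha>"
    and line: "\<And>t. X + t *\<^sub>R Z \<in> S"
  shows "G \<bullet> Z = 0"
proof (cases "Z = 0")
  case False
  \<comment> \<open>This is the minimizer of the squared distance along the line. Relative to
    \<open>t = 0\<close> the value changes by
    \<open>- (\<alpha> * (G \<bullet> Z))\<^sup>2 / (Z \<bullet> Z)\<close>, which minimality of
    \<open>X\<close> forces to be nonnegative.\<close>
  define t where "t = - \<alpha> * (G \<bullet> Z) / (Z \<bullet> Z)"
  have "norm (X - (X - \<alpha> *\<^sub>R G)) \<le> norm ((X + t *\<^sub>R Z) - (X - \<alpha> *\<^sub>R G))"
    using proj line by (simp only: proj_set_def) blast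
  moreover have "X + t *\<^sub>R Z - (X - \<alpha> *\<^sub>R G) = t *\<^sub>R Z + \<alpha> *\<^sub>R G"
    by simp
  ultimately have "(norm (\<alpha> *\<^sub>R G))\<^sup>2 \<le> (norm (t *\<^sub>R Z + \<alpha> *\<^sub>R G))\<^sup>2"
    by (intro power_mono) simp_all
  then have "0 \<le> t\<^sup>2 * (Z \<bullet> Z) + 2 * t * \<alpha> * (G \<bullet> Z)"
    unfolding power2_norm_eq_inner
    by (simp add: inner_add_left inner_add_right inner_commute power2_eq_square algebra_simps)
  also have "\<dots> = - (\<alpha> * (G \<bullet> Z))\<^sup>2 / (Z \<bullet> Z)"
    using False by (simp add: t_def power2_eq_square field_simps)
  finally have "(\<alpha> * (G \<bullet> Z))\<^sup>2 / (Z \<bullet> Z) \<le> 0"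
    by simp
  moreover have "0 < Z \<bullet> Z"
    using False by simp
  ultimately have "(\<alpha> * (G \<bullet> Z))\<^sup>2 \<le> 0"
    by (simp only: divide_le_0_iff) auto
  then show ?thesis using \<open>0 < \<alpha>\<close> by simp
qed simp

text \<open>Restriction to the line through \<open>x\<close> and \<open>y\<close> reduces this to
  the tangent inequality for convex functions of one real variable.\<close>

lemma convex_on_above_tangent_inner:
  fixes f :: "'a::real_inner \<Rightarrow> real"
  assumes conv: "convex_on UNIV f" and g: "GDERIV f x :> g"
  shows "f x + g \<bullet> (y - x) \<le> f y"
proof -
  define \<psi> where "\<psi> t = f (x + t *\<^sub>R (y - x))" for t :: real
  have "convex_on UNIV \<psi>"
  proof (rule convex_onI)
    fix t u v :: real assume "0 < t" "t < 1"
    then show "\<psi> ((1 - t) *\<^sub>R u + t *\<^sub>R v) \<le> (1 - t) * \<psi> u + t * \<psi> v"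
      using convex_onD[OF conv, of t "x + u *\<^sub>R (y - x)" "x + v *\<^sub>R (y - x)"]
      by (simp add: \<psi>_def algebra_simps)
  qed simp
  moreover have "(\<psi> has_field_derivative (g \<bullet> (y - x))) (at 0 within UNIV)"
  proof -
    have "((\<lambda>t. x + t *\<^sub>R (y - x)) has_derivative (\<lambda>t. t *\<^sub>R (y - x))) (at 0)"
      by (auto intro!: derivative_eq_intros)
    moreover have "(f has_derivative (\<lambda>h. h \<bullet> g)) (at (x + 0 *\<^sub>R (y - x)))"
      using g by (simp add: gderiv_def)
    ultimately have "(\<psi> has_derivative (\<lambda>t. (t *\<^sub>R (y - x)) \<bullet> g)) (at 0)"
      unfolding \<psi>_def by (rule has_derivative_compose)
    moreover have "(\<lambda>t. (t *\<^sub>R (y - x)) \<bullet> g) = (*) (g \<bullet> (y - x))"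
      by (simp add: fun_eq_iff inner_commute)
    ultimately show ?thesis
      by (simp add: has_field_derivative_def)
  qed
  ultimately have "(g \<bullet> (y - x)) * (1 - 0) \<le> \<psi> 1 - \<psi> 0"
    by (intro convex_on_imp_above_tangent) auto
  then show ?thesis by (simp add: \<psi>_def)
qed

section \<open>Directions along which the rank stays bounded\<close>

lemma rank_le_card:
  assumes "finite S" "\<And>v. M *v v \<in> span S"
  shows "rank (M :: real^'n^'m) \<le> card S"
proof -
  have "dim (range ((*v) M)) \<le> card S"
    using assms by (intro dim_le_card) auto
  then show ?thesis by (simp add: rank_dim_range)
qed

text \<open>A multiple of a matrix unit adds at most the one vector \<open>axis p 1\<close> to a
  spanning set of the range.\<close>

lemma rank_add_matrix_unit:
  fixes X :: "real^'n^'m"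
  shows "rank (X + t *\<^sub>R axis p (axis q 1)) \<le> Suc (rank X)"
proof -
  obtain B where B: "range ((*v) X) \<subseteq> span B" "independent B" "card B = dim (range ((*v) X))"
    by (metis basis_exists)
  have fin: "finite B" using B(2) by (rule independent_imp_finite)
  have "(X + t *\<^sub>R axis p (axis q 1)) *v v \<in> span (insert (axis p 1) B)" for v
  proof -
    have "(X + t *\<^sub>R axis p (axis q 1)) *v v = X *v v + (t * v $ q) *\<^sub>R axis p 1"
      by (simp add: vec_eq_iff matrix_vector_mult_def axis_def distrib_right sum.distrib
          if_distrib[of "\<lambda>t. t * _"] if_distrib[of "\<lambda>t. _ * t"] if_distrib[of "\<lambda>f. f $ _"] cong: if_cong)
    moreover have "X *v v \<in> span (insert (axis p 1) B)"
      using B(1) span_mono[of B "insert (axis p 1) B"] by blast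
    ultimately show ?thesis
      by (simp add: span_add span_base span_scale)
  qed
  then have "rank (X + t *\<^sub>R axis p (axis q 1)) \<le> card (insert (axis p 1) B)"
    using fin by (intro rank_le_card) auto
  also have "\<dots> \<le> Suc (rank X)"
    using fin B(3) by (simp add: rank_dim_range card_insert_if)
  finally show ?thesis .
qed

lemma RXJ_subspace: "subspace (RXJ \<iota> U V J)"
  unfolding subspace_def
proof (intro conjI ballI allI)
  show "0 \<in> RXJ \<iota> U V J"
    unfolding RXJ_def by (rule CollectI, rule exI[of _ "\<lambda>i j. 0"]) (simp add: vec_eq_iff)
next
  fix x y assume "x \<in> RXJ \<iota> U V J" "y \<in> RXJ \<iota> U V J"
  then obtain A B where "x = (\<chi> p q. \<Sum>i\<in>J. \<Sum>j\<in>J. U $ p $ \<iota> i * A i j * V $ q $ j)"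
    "y = (\<chi> p q. \<Sum>i\<in>J. \<Sum>j\<in>J. U $ p $ \<iota> i * B i j * V $ q $ j)"
    by (auto simp: RXJ_def)
  then show "x + y \<in> RXJ \<iota> U V J"
    unfolding RXJ_def
    by (intro CollectI exI[of _ "\<lambda>i j. A i j + B i j"]) (simp add: vec_eq_iff sum.distrib algebra_simps)
next
  fix c x assume "x \<in> RXJ \<iota> U V J"
  then obtain A where "x = (\<chi> p q. \<Sum>i\<in>J. \<Sum>j\<in>J. U $ p $ \<iota> i * A i j * V $ q $ j)"
    by (auto simp: RXJ_def)
  then show "c *\<^sub>R x \<in> RXJ \<iota> U V J"
    unfolding RXJ_def
    by (intro CollectI exI[of _ "\<lambda>i j. c * A i j"]) (simp add: vec_eq_iff sum_distrib_left algebra_simps)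
qed

text \<open>The range is spanned by the columns of \<open>U\<close> indexed by the image of
  \<open>J\<close>.\<close>

lemma RXJ_rank:
  assumes "Y \<in> RXJ \<iota> U V J"
  shows "rank Y \<le> card J"
proof -
  obtain A where Y: "Y = (\<chi> p q. \<Sum>i\<in>J. \<Sum>j\<in>J. U $ p $ \<iota> i * A i j * V $ q $ j)"
    using assms by (auto simp: RXJ_def)
  have "Y *v v \<in> span ((\<lambda>i. column (\<iota> i) U) ` J)" for v
  proof -
    have "Y *v v = (\<Sum>i\<in>J. (\<Sum>q\<in>UNIV. \<Sum>j\<in>J. A i j * V $ q $ j * v $ q) *\<^sub>R column (\<iota> i) U)"
      by (simp add: Y vec_eq_iff matrix_vector_mult_def column_def sum_distrib_right sum_distrib_left
          sum.swap[of _ J UNIV] mult_ac)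
    then show ?thesis
      by (simp add: span_sum span_scale span_base)
  qed
  then have "rank Y \<le> card ((\<lambda>i. column (\<iota> i) U) ` J)"
    by (intro rank_le_card) auto
  then show ?thesis
    using card_image_le[of J] by (meson finite order_trans)
qed

lemma svd_in_RXJ:
  assumes svd: "is_svd \<iota> X U d V"
  shows "X \<in> RXJ \<iota> U V (nz_index d)"
proof -
  have "X $ p $ q = (\<Sum>i\<in>nz_index d. \<Sum>j\<in>nz_index d. U $ p $ \<iota> i * (if i = j then d $ i else 0) * V $ q $ j)" for p q
  proof -
    have "X $ p $ q = (\<Sum>i\<in>UNIV. (U ** rect_diag \<iota> d) $ p $ i * V $ q $ i)"
      using svd by (simp add: is_svd_def matrix_matrix_mult_def[of "U ** _"] transpose_def)
    also have "\<dots> = (\<Sum>i\<in>UNIV. U $ p $ \<iota> i * d $ i * V $ q $ i)"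
      by (simp add: matrix_matrix_mult_def rect_diag_def if_distrib[of "\<lambda>t. _ * t"] cong: if_cong)
    also have "\<dots> = (\<Sum>i\<in>nz_index d. U $ p $ \<iota> i * d $ i * V $ q $ i)"
      by (rule sum.mono_neutral_right) (auto simp: nz_index_def)
    also have "\<dots> = (\<Sum>i\<in>nz_index d. \<Sum>j\<in>nz_index d. U $ p $ \<iota> i * (if i = j then d $ i else 0) * V $ q $ j)"
      by (rule sum.cong) (simp_all add: if_distrib[of "\<lambda>t. _ * t"] if_distrib[of "\<lambda>t. t * _"] cong: if_cong)
    finally show ?thesis .
  qed
  then show ?thesis
    unfolding RXJ_def
    by (intro CollectI exI[of _ "\<lambda>i j. if i = j then d $ i else 0"]) (simp add: vec_eq_iff)
qed


section \<open>Stationarity for rank equal to \<open>r\<close> and for rank below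
  \<open>r\<close>\<close>

lemma alpha_stationary_full_rank:
  assumes svd: "is_svd \<iota> X U d V" "inj \<iota>" and "1 \<le> rank X"
    and G: "lagr_grad g l A X y ** transpose X = 0" "transpose X ** lagr_grad g l A X y = 0"
    and X: "X \<in> affine_set l A b"
    and \<alpha>: "0 < \<alpha>" "ereal \<alpha> < step_bound g l A (rank X) X y"
  shows "alpha_stationary_with g l A b (rank X) \<alpha> y X"
proof -
  define H where "H = \<alpha> *\<^sub>R lagr_grad g l A X y"
  \<comment> \<open>This bounds the operator norm of \<open>transpose H\<close>. The step bound
    keeps it no larger than any nonzero diagonal entry, as the approximation inequality
    asks.\<close>
  define \<sigma> where "\<sigma> = \<alpha> * spectral_norm (lagr_grad g l A X y)"
  have \<sigma>: "0 \<le> \<sigma>"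
    using \<alpha>(1) spectral_norm_nonneg[of "lagr_grad g l A X y"] by (simp add: \<sigma>_def)
  have H: "H ** transpose X = 0" "transpose X ** H = 0"
    using G by (simp_all add: H_def bounded_bilinear.scaleR_left[OF bounded_bilinear_matrix_mult]
        bounded_bilinear.scaleR_right[OF bounded_bilinear_matrix_mult])
  have bound: "norm (transpose H *v w) \<le> \<sigma> * norm w" for w
    using mult_left_mono[OF norm_transpose_mult_le, of \<alpha> "lagr_grad g l A X y" w] \<alpha>(1)
    by (simp add: H_def \<sigma>_def transpose_scalar scaleR_matrix_vector_assoc[symmetric] mult.assoc
        del: transpose_matrix_vector)
  have d: "\<sigma> \<le> d $ q" if "q \<in> nz_index d" for q
  proof (cases "lagr_grad g l A X y = 0")
    case True
    then show ?thesis
      using svd(1) by (simp add: is_svd_def \<sigma>_def spectral_norm_def onorm_zero)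
  next
    case False
    then have *: "\<alpha> < singular_value (rank X) X / spectral_norm (lagr_grad g l A X y)"
      using \<alpha>(2) by (simp add: step_bound_def)
    \<comment> \<open>If the spectral norm were 0, the quotient would be 0 by the convention for
      division, contradicting \<open>0 < \<alpha>\<close>.\<close>
    then have "0 < spectral_norm (lagr_grad g l A X y)"
      using \<alpha>(1) spectral_norm_nonneg[of "lagr_grad g l A X y"]
      by (cases "spectral_norm (lagr_grad g l A X y) = 0") auto
    then have "\<sigma> < singular_value (rank X) X"
      using * by (simp add: \<sigma>_def less_divide_eq)
    then show ?thesis
      using svd_singular_value_rank_le[OF svd \<open>1 \<le> rank X\<close> that] by simp
  qed
  have "X \<in> proj_set (rank_le (rank X)) (X - H)"
    using best_approximation_orthogonal_perturbation[OF svd H bound \<sigma> d]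
    by (simp add: proj_set_def rank_le_def svd_rank[OF svd])
  then show ?thesis
    using X by (simp add: alpha_stationary_with_def affine_set_def H_def rank_le_def)
qed

lemma alpha_stationary_low_rank:
  fixes X :: "real^'n^'m"
  assumes svd: "is_svd \<iota> X U d V" "inj \<iota>" and r: "rank X < r" "r < CARD('n)"
    and X: "X \<in> affine_set l A b"
    and \<alpha>: "0 < \<alpha>" "ereal \<alpha> < step_bound g l A r X y"
  shows "alpha_stationary_with g l A b r \<alpha> y X"
proof -
  have "singular_value r X = 0"
    using svd_singular_value_zero[OF svd] r by simp
  \<comment> \<open>Otherwise the step bound would be 0 and leave no room for a positive
    \<open>\<alpha>\<close>.\<close>
  then have "lagr_grad g l A X y = 0"
    using \<alpha> by (auto simp: step_bound_def split: if_splits)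
  then show ?thesis
    using X r by (simp add: alpha_stationary_with_def affine_set_def rank_le_def proj_set_def)
qed

lemma lagr_grad_stationary_low_rank:
  assumes "alpha_stationary_with g l A b r \<alpha> y X" "0 < \<alpha>" "rank X < r"
  shows "lagr_grad g l A X y = 0"
proof -
  have "lagr_grad g l A X y \<bullet> axis p (axis q 1) = 0" for p q
  proof (rule proj_set_orthogonal)
    show "X \<in> proj_set (rank_le r) (X - \<alpha> *\<^sub>R lagr_grad g l A X y)"
      using assms by (simp add: alpha_stationary_with_def)
    show "X + t *\<^sub>R axis p (axis q 1) \<in> rank_le r" for t
      using rank_add_matrix_unit[of X t p q] assms(3) by (simp add: rank_le_def)
  qed fact
  then show ?thesis
    by (simp add: inner_axis vec_eq_iff)
qed

text \<open>Both \<open>X\<close> and \<open>Y\<close> lie in one linear space all of whose elements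
  have rank at most \<open>card (nz_index d)\<close>, that is \<open>rank X\<close>; so the line
  through them never leaves the set projected onto.\<close>

lemma lagr_grad_stationary_full_rank:
  assumes st: "alpha_stationary_with g l A b (rank X) \<alpha> y X" "0 < \<alpha>"
    and svd: "is_svd \<iota> X U d V" "inj \<iota>"
    and Y: "Y \<in> RXJ \<iota> U V (nz_index d)"
  shows "lagr_grad g l A X y \<bullet> (Y - X) = 0"
proof (rule proj_set_orthogonal)
  show "X \<in> proj_set (rank_le (rank X)) (X - \<alpha> *\<^sub>R lagr_grad g l A X y)"
    using st by (simp add: alpha_stationary_with_def)
  show "X + t *\<^sub>R (Y - X) \<in> rank_le (rank X)" for t
  proof -
    have "X + t *\<^sub>R (Y - X) \<in> RXJ \<iota> U V (nz_index d)"
      using Y svd_in_RXJ[OF svd(1)]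
      by (intro subspace_add subspace_scale subspace_diff RXJ_subspace)
    then show ?thesis
      using RXJ_rank by (fastforce simp: rank_le_def svd_rank[OF svd])
  qed
qed fact

text \<open>A difference of feasible points is orthogonal to every \<open>A i\<close>, so the
  multiplier terms drop out and the tangent inequality for \<open>f\<close> applies.\<close>

lemma convex_lagrangian_lower_bound:
  assumes "convex_on UNIV f" "GDERIV f X :> g X"
    and "X \<in> affine_set l A b" "Y \<in> affine_set l A b"
    and "lagr_grad g l A X y \<bullet> (Y - X) = 0"
  shows "f X \<le> f Y"
proof -
  have "A i \<bullet> (Y - X) = 0" if "i \<in> {1..l}" for i
    using assms(3,4) that by (simp add: affine_set_def inner_diff_right)
  then have "lagr_grad g l A X y \<bullet> (Y - X) = g X \<bullet> (Y - X)"
    by (simp add: lagr_grad_def inner_add_left inner_sum_left)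
  then show ?thesis
    using convex_on_above_tangent_inner[OF assms(1,2), of Y] assms(5) by simp
qed

theorem theorem3p2:
  fixes f :: "real^'n^'m \<Rightarrow> real"
    and grad :: "real^'n^'m \<Rightarrow> real^'n^'m"
    and A :: "nat \<Rightarrow> real^'n^'m"
    and b :: "nat \<Rightarrow> real"
    and l r s :: nat
    and X :: "real^'n^'m"
    and U :: "real^'m^'m"
    and d :: "real^'n"
    and V :: "real^'n^'n"
    and \<iota> :: "'n \<Rightarrow> 'm"
  assumes "CARD('n) \<le> CARD('m)" and "inj \<iota>"
    and "1 \<le> r" and "r < CARD('n)"
    and "\<And>Z. GDERIV f Z :> grad Z" and "continuous_on UNIV grad"
    and "X \<in> affine_set l A b \<inter> rank_le r" and "rank X = s"
    and "is_svd \<iota> X U d V"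
  shows
    "(local_minimizer f (affine_set l A b \<inter> rank_le r) X \<and>
      ((s = r \<and> assumption1 \<iota> U d V l A) \<or>
       (s < r \<and> assumption2 \<iota> U d V l A \<and>
        frechet_normal (RX \<iota> U d V r) X \<subseteq> bouligand_tangent (affine_set l A b) X))
      \<longrightarrow> (\<exists>y :: nat \<Rightarrow> real. \<forall>\<alpha> :: real.
            0 < \<alpha> \<and> ereal \<alpha> < step_bound grad l A r X y
            \<longrightarrow> alpha_stationary_with grad l A b r \<alpha> y X))
     \<and>
     (convex_on UNIV f \<and> (\<exists>\<alpha>>0. alpha_stationary grad l A b r \<alpha> X)
      \<longrightarrow> (s = r \<longrightarrow> global_minimizer f (affine_set l A b \<inter> RX \<iota> U d V r) X) \<and>
          (s < r \<longrightarrow> global_minimizer f (affine_set l A b \<inter> rank_le r) X))"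
proof (intro conjI impI)
  note svd = \<open>is_svd \<iota> X U d V\<close> \<open>inj \<iota>\<close>
  have XL: "X \<in> affine_set l A b" and Xr: "rank X \<le> r"
    using assms(7) by (auto simp: rank_le_def)
  {
    assume H: "local_minimizer f (affine_set l A b \<inter> rank_le r) X \<and>
      ((s = r \<and> assumption1 \<iota> U d V l A) \<or>
       (s < r \<and> assumption2 \<iota> U d V l A \<and>
        frechet_normal (RX \<iota> U d V r) X \<subseteq> bouligand_tangent (affine_set l A b) X))"
    show "\<exists>y. \<forall>\<alpha>. 0 < \<alpha> \<and> ereal \<alpha> < step_bound grad l A r X y
        \<longrightarrow> alpha_stationary_with grad l A b r \<alpha> y X"
    proof (cases "s = r")
      case True
      then have r: "r = rank X"
        using assms(8) by simp
      have "local_minimizer f (affine_set l A b \<inter> rank_le (rank X)) X" "assumption1 \<iota> U d V l A"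
        using H True r by auto
      then obtain y where "lagr_grad grad l A X y ** transpose X = 0" "transpose X ** lagr_grad grad l A X y = 0"
        using KKT_full_rank[OF assms(5) svd] by blast
      then show ?thesis
        using alpha_stationary_full_rank[OF svd _ _ _ XL] \<open>1 \<le> r\<close> unfolding r by blast
    next
      case False
      then have "rank X < r"
        using Xr assms(8) by simp
      then show ?thesis
        using alpha_stationary_low_rank[OF svd _ \<open>r < CARD('n)\<close> XL] by blast
    qed
  }
  {
    assume H: "convex_on UNIV f \<and> (\<exists>\<alpha>>0. alpha_stationary grad l A b r \<alpha> X)"
    then obtain \<alpha> y where st: "0 < \<alpha>" "alpha_stationary_with grad l A b r \<alpha> y X"
      by (auto simp: alpha_stationary_def)
    \<comment> \<open>Both global claims are thereby reduced to orthogonality of the Lagrangian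
      gradient to \<open>Y - X\<close>.\<close>
    have lower: "f X \<le> f Y" if "Y \<in> affine_set l A b" "lagr_grad grad l A X y \<bullet> (Y - X) = 0" for Y
      using convex_lagrangian_lower_bound[where f = f and g = grad] H assms(5) XL that by blast
    show "global_minimizer f (affine_set l A b \<inter> RX \<iota> U d V r) X" if "s = r"
    proof -
      have r: "r = rank X" "r = card (nz_index d)"
        using that assms(8) svd_rank[OF svd] by simp_all
      \<comment> \<open>An \<open>r\<close>-element set containing the \<open>r\<close>-element set
        \<open>nz_index d\<close> equals it, so the union defining \<open>RX\<close> collapses to a
        single linear space.\<close>
      have "J = nz_index d" if "card J = r" "nz_index d \<subseteq> J" for J
        using that r(2) by (metis card_subset_eq finite)
      then have "RX \<iota> U d V r = RXJ \<iota> U V (nz_index d)"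
        using r(2) unfolding RX_def by blast
      then show ?thesis
        using lagr_grad_stationary_full_rank[OF st(2)[unfolded r(1)] st(1) svd] lower XL svd_in_RXJ[OF svd(1)]
        by (auto simp: global_minimizer_def)
    qed
    show "global_minimizer f (affine_set l A b \<inter> rank_le r) X" if "s < r"
      using lagr_grad_stationary_low_rank[OF st(2,1)] that assms(7,8) lower
      by (auto simp: global_minimizer_def)
  }
qed

end
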